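(* Let $\xi$ and $\xi'$ be (locally finite) Poisson point processes on $[0,\infty)$ with intensity measures $\mu$ and $\mu'$, respectively, with $\mu(\{0\})=\mu'(\{0\})=1$, and with $\mu((0,t])>0$ and $\mu'((0,t])>0$ for all $t>0$. Assume that $\mu'_+(t)=\mu'((0,t])$ satisfies the following condition: there exists a function $\varphi:[0,\infty)\to[0,\infty)$ with $\lim_{\lambda\to 0}\varphi(\lambda)=0$ such that $$\limsup_{(t,\lambda)\to 0}\frac{\mu'_+(\lambda t)}{\varphi(\lambda)\,\mu'_+(t)}<\infty .$$ Assume also that $$\limsup_{t\downarrow 0}\frac{\mu((0,t])}{\mu'((0,t])}<\infty .$$ Then, if $\xi$ yields an explosive CMJ process, so does $\xi'$.
   Context: The first limsup is over $t,\lambda>0$ with $(t,\lambda)\to(0,0)$; a quotient with zero denominator is read as $+\infty$ (so $\varphi(\lambda)>0$ for small $\lambda>0$). A reproduction point process $\xi$ is a random point measure on $[0,\infty)$ that is locally finite: $\xi[0,t]<\infty$ almost surely for all $t\ge 0$. Its intensity measure is $\mu(B)=\mathbf{E}[\xi(B)]$ for Borel $B$; Poisson point processes may have atoms in their intensity measure. Write $\xi=\sum_{j=1}^N\delta_{X_j}$ with $N=\xi[0,\infty)\in\mathbb{N}_0\cup\{\infty\}$ and $X_j=\inf\{t\ge 0:\xi[0,t]\ge j\}$ ($\inf\varnothing=\infty$). Crump-Mode-Jagers (CMJ) process driven by $\xi$: let $\mathcal{I}=\{\varnothing\}\cup\bigcup_{n\in\mathbb{N}}\mathbb{N}^n$ be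 the set of labels, and let $(\xi_u)_{u\in\mathcal{I}}$ be i.i.d. copies of $\xi$, with $X_{u,j}$ defined from $\xi_u$ as $X_j$ is from $\xi$. Birth times are $S(\varnothing)=0$ and $S(uj)=S(u)+X_{u,j}$ for $u\in\mathcal{I}$, $j\in\mathbb{N}$ (individuals with $S(u)=\infty$ are never born). Let $\mathcal{Z}_t=\#\{u\in\mathcal{I}:S(u)\le t\}$ and let $T=\inf\{t\ge 0:\mathcal{Z}_t=\infty\}\in[0,\infty]$ be the explosion time. One says that $\xi$ yields an explosive CMJ process if $\mathbf{P}(T<\infty)>0$. *)

theory Defs
  imports "HOL-Probability.Probability"
begin

section \<open>Point processes on the half-line\<close>

definition half_line :: "real measure" where
  "half_line = restrict_space borel {0..}"

text \<open>The space of \<open>\<nat>\<^sub>0 \<union> {\<infinity>}\<close>-valued measures on a measurable space \<open>K\<close>, with the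
  \<open>\<sigma>\<close>-algebra generated by the evaluations \<open>N \<mapsto> N(A)\<close>; compare \<^const>\<open>subprob_algebra\<close>.\<close>

definition point_measures :: "'b measure \<Rightarrow> 'b measure set" where
  "point_measures K = {N. sets N = sets K \<and> (\<forall>A\<in>sets K. emeasure N A \<in> insert \<infinity> (range of_nat))}"

definition point_measure_algebra :: "'b measure \<Rightarrow> 'b measure measure" where
  "point_measure_algebra K =
     (SUP A \<in> sets K. vimage_algebra (point_measures K) (\<lambda>N. emeasure N A) borel)"

definition reproduction_process :: "'a measure \<Rightarrow> ('a \<Rightarrow> real measure) \<Rightarrow> bool" where
  "reproduction_process M \<xi> \<longleftrightarrow>
     prob_space M \<and>
     \<xi> \<in> M \<rightarrow>\<^sub>M point_measure_algebra half_line \<and>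
     (\<forall>t\<ge>0. AE \<omega> in M. emeasure (\<xi> \<omega>) {0..t} < \<infinity>)"

definition has_intensity :: "'a measure \<Rightarrow> ('a \<Rightarrow> real measure) \<Rightarrow> real measure \<Rightarrow> bool" where
  "has_intensity M \<xi> \<mu> \<longleftrightarrow>
     sets \<mu> = sets half_line \<and>
     (\<forall>B\<in>sets half_line. emeasure \<mu> B = (\<integral>\<^sup>+\<omega>. emeasure (\<xi> \<omega>) B \<partial>M))"

text \<open>The Poisson weights are written out because \<^const>\<open>poisson_pmf\<close> is unspecified at rate \<open>0\<close>.
  A set of infinite intensity carries infinitely many points almost surely.\<close>

definition poisson_point_process ::
    "'a measure \<Rightarrow> ('a \<Rightarrow> real measure) \<Rightarrow> real measure \<Rightarrow> bool" where
  "poisson_point_process M \<xi> \<mu> \<longleftrightarrow>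
     reproduction_process M \<xi> \<and>
     has_intensity M \<xi> \<mu> \<and>
     (\<forall>B\<in>sets half_line. emeasure \<mu> B < \<infinity> \<longrightarrow>
        (\<forall>k::nat. measure M {\<omega>\<in>space M. emeasure (\<xi> \<omega>) B = of_nat k} =
           exp (- measure \<mu> B) * measure \<mu> B ^ k / fact k)) \<and>
     (\<forall>B\<in>sets half_line. emeasure \<mu> B = \<infinity> \<longrightarrow> (AE \<omega> in M. emeasure (\<xi> \<omega>) B = \<infinity>)) \<and>
     (\<forall>(I :: nat set) A. finite I \<longrightarrow> A ` I \<subseteq> sets half_line \<longrightarrow> disjoint_family_on A I \<longrightarrow>
        prob_space.indep_vars M (\<lambda>_. borel) (\<lambda>i \<omega>. emeasure (\<xi> \<omega>) (A i)) I)"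


text \<open>On \<^typ>\<open>ennreal\<close> one has \<open>0 / 0 = 0\<close>; here every quotient with zero denominator is \<open>\<infinity>\<close>.\<close>

definition extended_quotient :: "ennreal \<Rightarrow> ennreal \<Rightarrow> ennreal" where
  "extended_quotient a b = (if b = 0 then \<infinity> else a / b)"


section \<open>Crump-Mode-Jagers processes\<close>

definition labels :: "nat list set" where
  "labels = lists {1..}"

definition point_location :: "real measure \<Rightarrow> nat \<Rightarrow> ennreal" where
  "point_location N j = (INF t \<in> {t::real. 0 \<le> t \<and> of_nat j \<le> emeasure N {0..t}}. ennreal t)"

text \<open>\<open>birth_time \<Xi> u\<close> is the sum of the displacements along the ancestral line of \<open>u\<close>; the
  list \<open>take i u\<close> is the ancestor of \<open>u\<close> in generation \<open>i\<close>.\<close>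

definition birth_time :: "(nat list \<Rightarrow> real measure) \<Rightarrow> nat list \<Rightarrow> ennreal" where
  "birth_time \<Xi> u = (\<Sum>i<length u. point_location (\<Xi> (take i u)) (u ! i))"

lemma birth_time_Nil: "birth_time \<Xi> [] = 0"
  by (simp add: birth_time_def)

lemma birth_time_snoc: "birth_time \<Xi> (u @ [j]) = birth_time \<Xi> u + point_location (\<Xi> u) j"
  by (simp add: birth_time_def nth_append)

definition population :: "(nat list \<Rightarrow> real measure) \<Rightarrow> real \<Rightarrow> ennreal" where
  "population \<Xi> t = emeasure (count_space labels) {u \<in> labels. birth_time \<Xi> u \<le> ennreal t}"

definition explosion_time :: "(nat list \<Rightarrow> real measure) \<Rightarrow> ennreal" where
  "explosion_time \<Xi> = (INF t \<in> {t. 0 \<le> t \<and> population \<Xi> t = \<infinity>}. ennreal t)"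

text \<open>The i.i.d. copies of \<open>\<xi>\<close> are the coordinates of the product, over all labels, of the law
  of \<open>\<xi>\<close>.\<close>

definition iid_copies :: "'a measure \<Rightarrow> ('a \<Rightarrow> real measure) \<Rightarrow> (nat list \<Rightarrow> real measure) measure" where
  "iid_copies M \<xi> = (\<Pi>\<^sub>M u\<in>labels. distr M (point_measure_algebra half_line) \<xi>)"

definition explosive :: "'a measure \<Rightarrow> ('a \<Rightarrow> real measure) \<Rightarrow> bool" where
  "explosive M \<xi> \<longleftrightarrow>
     0 < measure (iid_copies M \<xi>) {\<Xi> \<in> space (iid_copies M \<xi>). explosion_time \<Xi> < \<infinity>}"

text \<open>The explosion event is measurable, so the probability above is genuine.\<close>

lemma measurable_emeasure_point_measure_algebra:
  "A \<in> sets K \<Longrightarrow> (\<lambda>N. emeasure N A) \<in> borel_measurable (point_measure_algebra K)"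
  by (auto intro!: measurable_Sup1 measurable_vimage_algebra1 simp: point_measure_algebra_def)

lemma interval_in_half_line: "{0..t} \<in> sets half_line"
  by (auto simp: half_line_def sets_restrict_space_iff)

lemma measurable_point_location:
  "(\<lambda>N. point_location N j) \<in> borel_measurable (point_measure_algebra half_line)"
proof (rule borel_measurableI_less)
  fix y :: ennreal
  have eq: "point_location N j < y \<longleftrightarrow>
      (\<exists>q::rat. 0 \<le> q \<and> ennreal (of_rat q) < y \<and> of_nat j \<le> emeasure N {0..of_rat q})"
    if N: "sets N = sets half_line" for N
  proof
    assume "point_location N j < y"
    then obtain t where t: "0 \<le> t" "of_nat j \<le> emeasure N {0..t}" "ennreal t < y"
      by (auto simp: point_location_def INF_less_iff)
    obtain s :: real where s: "t < s" "ennreal s < y"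
    proof (cases y)
      case (real r)
      with t have "t < r" by (simp add: ennreal_less_iff)
      then obtain s where "t < s" "s < r" using dense by blast
      with t real show ?thesis by (intro that) (auto simp: ennreal_less_iff)
    next
      case top
      show ?thesis by (rule that[of "t + 1"]) (auto simp: top)
    qed
    obtain q where q: "t < of_rat q" "of_rat q < s" using of_rat_dense[OF s(1)] by blast
    have "emeasure N {0..t} \<le> emeasure N {0..of_rat q}"
      by (rule emeasure_mono) (use q N interval_in_half_line in auto)
    moreover have "ennreal (of_rat q) < y"
      using q s(2) by (meson ennreal_leI le_less_trans less_imp_le)
    moreover have "(0::real) \<le> of_rat q" using q t(1) by linarith
    ultimately show "\<exists>q::rat. 0 \<le> q \<and> ennreal (of_rat q) < y \<and> of_nat j \<le> emeasure N {0..of_rat q}"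
      using t(2) by (intro exI[of _ q]) auto
  next
    assume "\<exists>q::rat. 0 \<le> q \<and> ennreal (of_rat q) < y \<and> of_nat j \<le> emeasure N {0..of_rat q}"
    then obtain q :: rat where "0 \<le> q" "ennreal (of_rat q) < y" "of_nat j \<le> emeasure N {0..of_rat q}"
      by blast
    then show "point_location N j < y"
      by (auto simp: point_location_def INF_less_iff intro!: exI[of _ "of_rat q"])
  qed
  have space: "space (point_measure_algebra half_line) \<subseteq> {N. sets N = sets half_line}"
    by (auto simp: point_measure_algebra_def space_Sup_eq_UN point_measures_def)
  have [measurable]: "(\<lambda>N. emeasure N {0..t}) \<in> borel_measurable (point_measure_algebra half_line)" for t
    by (intro measurable_emeasure_point_measure_algebra interval_in_half_line)
  have "{N \<in> space (point_measure_algebra half_line).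
      \<exists>q::rat. 0 \<le> q \<and> ennreal (of_rat q) < y \<and> of_nat j \<le> emeasure N {0..of_rat q}}
      \<in> sets (point_measure_algebra half_line)"
    by measurable
  also have "{N \<in> space (point_measure_algebra half_line).
      \<exists>q::rat. 0 \<le> q \<and> ennreal (of_rat q) < y \<and> of_nat j \<le> emeasure N {0..of_rat q}} =
      {N \<in> space (point_measure_algebra half_line). point_location N j < y}"
    using eq space by blast
  finally show "{N \<in> space (point_measure_algebra half_line). point_location N j < y}
      \<in> sets (point_measure_algebra half_line)" .
qed

lemma measurable_birth_time:
  assumes "u \<in> labels"
  shows "(\<lambda>\<Xi>. birth_time \<Xi> u) \<in> borel_measurable (iid_copies M \<xi>)"
proof -
  have "(\<lambda>\<Xi>. point_location (\<Xi> (take i u)) (u ! i)) \<in> borel_measurable (iid_copies M \<xi>)" for i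
  proof -
    have "take i u \<in> labels"
      using assms by (auto simp: labels_def dest: in_set_takeD)
    then have "(\<lambda>\<Xi>. \<Xi> (take i u)) \<in> iid_copies M \<xi> \<rightarrow>\<^sub>M distr M (point_measure_algebra half_line) \<xi>"
      unfolding iid_copies_def by (rule measurable_component_singleton)
    from measurable_compose[OF this, of "\<lambda>N. point_location N (u ! i)" borel]
    show ?thesis using measurable_point_location by simp
  qed
  then show ?thesis by (simp add: birth_time_def)
qed

lemma explosion_time_finite_iff:
  "explosion_time \<Xi> < \<infinity> \<longleftrightarrow>
     (\<exists>n::nat. \<forall>k. \<exists>u. k \<le> to_nat u \<and> u \<in> labels \<and> birth_time \<Xi> u \<le> of_nat n)"
proof -
  have pop: "population \<Xi> t = \<infinity> \<longleftrightarrow> infinite {u \<in> labels. birth_time \<Xi> u \<le> ennreal t}" for t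
    by (auto simp: population_def emeasure_count_space)
  have mono: "population \<Xi> s = \<infinity>" if "population \<Xi> t = \<infinity>" "t \<le> s" for s t
  proof -
    have "{u \<in> labels. birth_time \<Xi> u \<le> ennreal t} \<subseteq> {u \<in> labels. birth_time \<Xi> u \<le> ennreal s}"
      using ennreal_leI[OF that(2)] by (auto intro: order_trans)
    with that(1) show ?thesis
      unfolding pop using infinite_super by blast
  qed
  have unbounded: "population \<Xi> (real n) = \<infinity> \<longleftrightarrow>
      (\<forall>k. \<exists>u. k \<le> to_nat u \<and> u \<in> labels \<and> birth_time \<Xi> u \<le> of_nat n)" for n
  proof -
    let ?A = "{u \<in> labels. birth_time \<Xi> u \<le> of_nat n}"
    have "infinite ?A \<longleftrightarrow> infinite (to_nat ` ?A)"
      by (simp add: finite_image_iff inj_on_def)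
    also have "\<dots> \<longleftrightarrow> (\<forall>k. \<exists>u. k \<le> to_nat u \<and> u \<in> ?A)"
      unfolding infinite_nat_iff_unbounded_le by blast
    finally show ?thesis
      unfolding pop by (simp add: ennreal_of_nat_eq_real_of_nat)
  qed
  have "explosion_time \<Xi> < \<infinity> \<longleftrightarrow> (\<exists>t\<ge>0. population \<Xi> t = \<infinity>)"
    by (auto simp: explosion_time_def INF_less_iff)
  also have "\<dots> \<longleftrightarrow> (\<exists>n::nat. population \<Xi> (real n) = \<infinity>)"
    using mono real_arch_simple by (meson of_nat_0_le_iff)
  finally show ?thesis by (simp only: unbounded)
qed

lemma measurable_explosion:
  "{\<Xi> \<in> space (iid_copies M \<xi>). explosion_time \<Xi> < \<infinity>} \<in> sets (iid_copies M \<xi>)"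
proof -
  have [measurable]: "Measurable.pred (iid_copies M \<xi>)
      (\<lambda>\<Xi>. u \<in> labels \<and> birth_time \<Xi> u \<le> of_nat n)" for u n
  proof (cases "u \<in> labels")
    case True
    note [measurable] = measurable_birth_time[OF True]
    show ?thesis using True by simp
  qed simp
  show ?thesis unfolding explosion_time_finite_iff by measurable
qed

lemma prob_space_iid_copies:
  assumes "reproduction_process M \<xi>"
  shows "prob_space (iid_copies M \<xi>)"
  unfolding iid_copies_def using assms
  by (intro prob_space_PiM prob_space.prob_space_distr) (auto simp: reproduction_process_def)

end

theory Submission
  imports Defs
begin

text \<open>Let \<open>q(t)\<close> be the probability that every generation has a member born by time \<open>t\<close>; the
  process explodes with positive probability iff \<open>q\<close> is not identically \<open>0\<close>. Splitting the family
  tree at the root and using the Laplace functional of the Poisson process, \<open>q\<close> is the largest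
  (sub)solution with values in \<open>[0, 1]\<close> of \<open>q(t) = 1 - exp (- \<integral>\<^bsub>[0,t]\<^esub> q(t - s) \<mu>(ds))\<close>. By maximality,
  \<open>q\<close> is positive on all of \<open>(0, \<infinity>)\<close> as soon as it is positive somewhere.

  Since \<open>\<mu>{0} = 1\<close>, the equation is \<open>- ln (1 - q(t)) - q(t) = \<integral>\<^bsub>(0,t]\<^esub> q(t - s) \<mu>(ds)\<close>, whose left-hand
  side is quadratic in \<open>q\<close> to first order. If \<open>\<mu>(0,s] \<le> C \<mu>'(0,s]\<close> for small \<open>s\<close>, monotonicity of \<open>q\<close>
  turns this into \<open>\<integral> q(t - s) \<mu>(ds) \<le> C \<integral> q(t - s) \<mu>'(ds)\<close>, and \<open>q / C\<close> is a subsolution of the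
  equation for \<open>\<mu>'\<close>.\<close>

section \<open>Locally finite point measures\<close>

lemma space_point_measure_algebra: "space (point_measure_algebra K) = point_measures K"
proof -
  have "sets K \<noteq> {}" by auto
  then show ?thesis by (auto simp: point_measure_algebra_def space_Sup_eq_UN)
qed

lemma sets_half_line_iff: "B \<in> sets half_line \<longleftrightarrow> B \<in> sets borel \<and> B \<subseteq> {0..}"
  by (auto simp: half_line_def sets_restrict_space_iff)

lemma measurable_half_lineI: "g \<in> borel_measurable borel \<Longrightarrow> g \<in> borel_measurable half_line"
  unfolding half_line_def by (rule measurable_restrict_space1)

definition locally_finite :: "real measure \<Rightarrow> bool" where
  "locally_finite N \<longleftrightarrow> N \<in> point_measures half_line \<and> (\<forall>t. emeasure N {0..t} < \<infinity>)"

text \<open>Collects indices, not locations, so that multiple points keep their multiplicity. Index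
  0 is left out because \<open>point_location N 0\<close> is 0 for every \<open>N\<close> and labels
  use positive letters only.\<close>

definition points_upto :: "real measure \<Rightarrow> real \<Rightarrow> nat set" where
  "points_upto N t = {j. 1 \<le> j \<and> point_location N j \<le> ennreal t}"

lemma locally_finite_sets: "locally_finite N \<Longrightarrow> sets N = sets half_line"
  by (simp add: locally_finite_def point_measures_def)

text \<open>The infimum defining a location is attained, because the count of \<open>{0..x}\<close>
  is right-continuous in \<open>x\<close>; this is continuity from above, which rests on finite
  counts.\<close>

lemma point_location_le_iff:
  assumes N: "locally_finite N" and x: "0 \<le> x"
  shows "point_location N j \<le> ennreal x \<longleftrightarrow> of_nat j \<le> emeasure N {0..x}"
proof
  assume "of_nat j \<le> emeasure N {0..x}"
  then show "point_location N j \<le> ennreal x"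
    unfolding point_location_def using x by (intro INF_lower) auto
next
  assume le: "point_location N j \<le> ennreal x"
  \<comment> \<open>Intervals strictly longer than \<open>{0..x}\<close>: an infimum at most
    \<open>x\<close> only yields admissible times slightly beyond \<open>x\<close>.\<close>
  define I where "I n = {0..x + 1 / real (Suc n)}" for n
  have I_sets: "range I \<subseteq> sets N"
    using interval_in_half_line locally_finite_sets[OF N] by (auto simp: I_def)
  have dec: "decseq I"
    unfolding decseq_Suc_iff I_def by (auto simp: field_simps)
  have "(INF n. emeasure N (I n)) = emeasure N (\<Inter>n. I n)"
    using N by (intro INF_emeasure_decseq[OF I_sets dec]) (simp add: I_def locally_finite_def less_top)
  also have "(\<Inter>n. I n) = {0..x}"
  proof (intro equalityI subsetI)
    fix y assume y: "y \<in> (\<Inter>n. I n)"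
    have "y \<le> x"
    proof (rule ccontr)
      assume "\<not> y \<le> x"
      then obtain n where "1 / real (Suc n) < y - x"
        using nat_approx_posE[of "y - x"] by auto
      moreover have "y \<in> I n" using y by blast
      ultimately show False by (simp add: I_def)
    qed
    moreover have "y \<in> I 0" using y by blast
    ultimately show "y \<in> {0..x}" by (simp add: I_def)
  next
    fix y assume y: "y \<in> {0..x}"
    have "0 \<le> 1 / real (Suc n)" for n by simp
    with y show "y \<in> (\<Inter>n. I n)" unfolding I_def by (force intro: order_trans)
  qed
  finally have eq: "(INF n. emeasure N (I n)) = emeasure N {0..x}" .
  have "of_nat j \<le> emeasure N (I n)" for n
  proof -
    have "ennreal x < ennreal (x + 1 / real (Suc n))"
      using x by (intro ennreal_lessI) (auto intro: add_nonneg_pos)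
    with le have "point_location N j < ennreal (x + 1 / real (Suc n))"
      by (rule le_less_trans)
    then obtain t where t: "0 \<le> t" "of_nat j \<le> emeasure N {0..t}"
        "ennreal t < ennreal (x + 1 / real (Suc n))"
      by (auto simp: point_location_def INF_less_iff)
    have "emeasure N {0..t} \<le> emeasure N (I n)"
      using I_sets t(1,3) by (intro emeasure_mono) (auto simp: I_def ennreal_less_iff)
    with t(2) show ?thesis by (rule order_trans)
  qed
  then have "of_nat j \<le> (INF n. emeasure N (I n))"
    by (intro INF_greatest)
  then show "of_nat j \<le> emeasure N {0..x}" by (simp only: eq)
qed

lemma locally_finite_count:
  assumes "locally_finite N" and "A \<in> sets half_line" and "A \<subseteq> {0..t}"
  obtains n :: nat where "emeasure N A = of_nat n"
proof -
  have "emeasure N A \<le> emeasure N {0..t}"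
    using assms interval_in_half_line locally_finite_sets[OF assms(1)] by (intro emeasure_mono) auto
  also have "\<dots> < \<infinity>" using assms by (simp add: locally_finite_def)
  finally have "emeasure N A \<noteq> \<infinity>" by simp
  with assms that show ?thesis by (auto simp: locally_finite_def point_measures_def)
qed

lemma points_upto_eq:
  assumes N: "locally_finite N" and "0 \<le> t" and n: "emeasure N {0..t} = of_nat n"
  shows "points_upto N t = {1..n}"
  unfolding points_upto_def point_location_le_iff[OF N \<open>0 \<le> t\<close>] n of_nat_le_iff by auto

lemma finite_points_upto:
  assumes N: "locally_finite N" and "0 \<le> t"
  shows "finite (points_upto N t)"
proof -
  obtain n where "emeasure N {0..t} = of_nat n"
    using locally_finite_count[OF N interval_in_half_line, of t t] by auto
  then show ?thesis using points_upto_eq[OF assms] by simp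
qed

lemma points_upto_location:
  assumes "j \<in> points_upto N t" "0 \<le> t"
  shows "enn2real (point_location N j) \<in> {0..t}"
    and "point_location N j = ennreal (enn2real (point_location N j))"
proof -
  from assms have "point_location N j \<le> ennreal t" by (simp add: points_upto_def)
  then have "point_location N j < top" using ennreal_less_top le_less_trans by blast
  then show "point_location N j = ennreal (enn2real (point_location N j))" by simp
  show "enn2real (point_location N j) \<in> {0..t}"
    using assms by (auto simp: points_upto_def enn2real_leI)
qed

text \<open>On \<open>{0..t}\<close> a point measure is the counting measure of its listed
  locations: both sides are finite Borel measures in \<open>B\<close>, they agree on half-lines by
  \<open>point_location_le_iff\<close>, and a finite measure is determined by its distribution
  function.\<close>

lemma emeasure_eq_card_points:
  assumes N: "locally_finite N" and t: "0 \<le> t" and B: "B \<in> sets borel"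
  shows "emeasure N (B \<inter> {0..t}) =
    of_nat (card {j \<in> points_upto N t. enn2real (point_location N j) \<in> B})"
proof -
  define X where "X j = enn2real (point_location N j)" for j
  define J where "J = points_upto N t"
  have fin: "finite J" unfolding J_def by (rule finite_points_upto[OF N t])
  note sets = locally_finite_sets[OF N]
  \<comment> \<open>\<open>N\<close> lives on the half-line, whereas uniqueness of distribution
    functions concerns Borel measures on the whole line; hence the restriction to
    \<open>{0..t}\<close> is pushed forward to \<open>borel\<close>.\<close>
  define \<nu>1 where "\<nu>1 = distr (density N (indicator {0..t})) borel (\<lambda>x. x)"
  define \<nu>2 where "\<nu>2 = distr (count_space J) borel X"
  have id: "(\<lambda>x. x) \<in> N \<rightarrow>\<^sub>M borel"
    using measurable_half_lineI[of "\<lambda>x. x"] by (simp add: measurable_cong_sets[OF sets refl])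
  have space_N: "space N = {0..}"
    using sets_eq_imp_space_eq[OF sets] by (simp add: half_line_def space_restrict_space)
  have It: "{0..t} \<in> sets N" using interval_in_half_line sets by auto
  have \<nu>1: "emeasure \<nu>1 A = emeasure N (A \<inter> {0..t})" if A: "A \<in> sets borel" for A
  proof -
    have AN: "A \<inter> {0..} \<in> sets N" using A by (auto simp: sets sets_half_line_iff)
    have "emeasure \<nu>1 A = emeasure (density N (indicator {0..t})) (A \<inter> {0..})"
      unfolding \<nu>1_def using id A by (subst emeasure_distr) (auto simp: space_N)
    also have "\<dots> = (\<integral>\<^sup>+x. indicator {0..t} x * indicator (A \<inter> {0..}) x \<partial>N)"
      using AN It by (subst emeasure_density) auto
    also have "\<dots> = (\<integral>\<^sup>+x. indicator (A \<inter> {0..t}) x \<partial>N)"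
      by (intro nn_integral_cong) (auto split: split_indicator)
    also have "\<dots> = emeasure N (A \<inter> {0..t})"
      using A by (intro nn_integral_indicator) (auto simp: sets sets_half_line_iff)
    finally show ?thesis .
  qed
  have \<nu>2: "emeasure \<nu>2 A = of_nat (card {j \<in> J. X j \<in> A})" if A: "A \<in> sets borel" for A
  proof -
    have "emeasure \<nu>2 A = emeasure (count_space J) (X -` A \<inter> J)"
      unfolding \<nu>2_def using A by (subst emeasure_distr) auto
    also have "X -` A \<inter> J = {j \<in> J. X j \<in> A}" by auto
    also have "emeasure (count_space J) \<dots> = of_nat (card {j \<in> J. X j \<in> A})"
      using fin by (subst emeasure_count_space_finite) auto
    finally show ?thesis .
  qed
  have f1: "finite_borel_measure \<nu>1"
  proof (intro finite_borel_measure.intro finite_borel_measure_axioms.intro finite_measureI)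
    show "emeasure \<nu>1 (space \<nu>1) \<noteq> \<infinity>"
      using \<nu>1[of UNIV] N by (simp add: \<nu>1_def locally_finite_def less_top)
  qed (simp add: \<nu>1_def)
  have f2: "finite_borel_measure \<nu>2"
  proof (intro finite_borel_measure.intro finite_borel_measure_axioms.intro finite_measureI)
    show "emeasure \<nu>2 (space \<nu>2) \<noteq> \<infinity>"
      using \<nu>2[of UNIV] by (simp add: \<nu>2_def)
  qed (simp add: \<nu>2_def)
  have "\<nu>1 = \<nu>2"
  proof (rule cdf_unique'[OF f1 f2], rule ext)
    fix x :: real
    have "emeasure \<nu>1 {..x} = emeasure \<nu>2 {..x}"
    proof (cases "x < 0")
      case True
      then have "{..x} \<inter> {0..t} = {}" "{j \<in> J. X j \<le> x} = {}"
        using less_le_trans[OF True enn2real_nonneg] by (auto simp: X_def not_le)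
      then show ?thesis by (simp only: \<nu>1 \<nu>2 borel_closed closed_atMost atMost_iff) simp
    next
      case False
      define y where "y = min x t"
      have y: "0 \<le> y" using False t by (simp add: y_def)
      obtain n where n: "emeasure N {0..y} = of_nat n"
        using locally_finite_count[OF N interval_in_half_line, of y y] by auto
      have "{j \<in> J. X j \<le> x} = points_upto N y"
      proof -
        have "j \<in> J \<and> X j \<le> x \<longleftrightarrow> j \<in> points_upto N y" for j
        proof (cases "j \<in> J")
          case True
          note loc = points_upto_location[OF True[unfolded J_def] t, folded X_def]
          have "j \<in> points_upto N y \<longleftrightarrow> X j \<le> y"
            using True loc(2) y by (subst points_upto_def) (simp add: J_def points_upto_def)
          with True loc(1) show ?thesis by (auto simp: y_def)
        next
          case False
          have "ennreal y \<le> ennreal t" by (intro ennreal_leI) (simp add: y_def)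
          with False show ?thesis by (auto simp: J_def points_upto_def)
        qed
        then show ?thesis by blast
      qed
      also have "\<dots> = {1..n}" by (rule points_upto_eq[OF N y n])
      finally have "emeasure \<nu>2 {..x} = of_nat n" by (simp add: \<nu>2)
      moreover have "{..x} \<inter> {0..t} = {0..y}" by (auto simp: y_def)
      moreover have "emeasure \<nu>1 {..x} = emeasure N ({..x} \<inter> {0..t})" by (rule \<nu>1) simp
      ultimately show ?thesis using n by (simp only:)
    qed
    then show "cdf \<nu>1 x = cdf \<nu>2 x" by (simp add: cdf_def measure_def)
  qed
  then show ?thesis using \<nu>1[OF B] \<nu>2[OF B] by (simp add: J_def X_def)
qed

section \<open>The Laplace functional of a Poisson process\<close>

text \<open>The probability generating function of a Poisson variable, summed from the exponential
  series. With the weights written out it also covers \<open>m = 0\<close>, where \<open>K\<close>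
  vanishes almost surely.\<close>

lemma expectation_power_poisson:
  fixes K :: "'a \<Rightarrow> nat"
  assumes "prob_space M" and K [measurable]: "K \<in> M \<rightarrow>\<^sub>M count_space UNIV"
    and P: "\<And>k. measure M {\<omega> \<in> space M. K \<omega> = k} = exp (- m) * m ^ k / fact k"
    and m: "0 \<le> m" and y: "0 \<le> y"
  shows "(\<integral>\<omega>. y ^ K \<omega> \<partial>M) = exp (- ((1 - y) * m))"
proof -
  interpret prob_space M by fact
  define p where "p k = exp (- m) * m ^ k / fact k" for k
  have p: "0 \<le> p k" for k using m by (simp add: p_def)
  have distr: "distr M (count_space UNIV) K = density (count_space UNIV) (\<lambda>k. ennreal (p k))"
  proof (rule measure_eqI_countable[where A=UNIV])
    fix k :: nat
    have "emeasure (distr M (count_space UNIV) K) {k} = emeasure M {\<omega> \<in> space M. K \<omega> = k}"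
      by (subst emeasure_distr) (auto intro!: arg_cong[where f="emeasure M"])
    also have "\<dots> = ennreal (p k)"
      by (simp add: emeasure_eq_measure P p_def)
    also have "\<dots> = emeasure (density (count_space UNIV) (\<lambda>k. ennreal (p k))) {k}"
      by (subst emeasure_density) (auto simp: nn_integral_count_space_indicator[symmetric] nn_integral_indicator_singleton)
    finally show "emeasure (distr M (count_space UNIV) K) {k} =
        emeasure (density (count_space UNIV) (\<lambda>k. ennreal (p k))) {k}" .
  qed auto
  have "(\<lambda>k. exp (- m) * ((m * y) ^ k /\<^sub>R fact k)) sums (exp (- m) * exp (m * y))"
    by (intro sums_mult exp_converges)
  then have sums: "(\<lambda>k. p k * y ^ k) sums exp (- ((1 - y) * m))"
    by (simp add: p_def power_mult_distrib field_simps exp_add[symmetric])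
  have "(\<integral>\<^sup>+\<omega>. ennreal (y ^ K \<omega>) \<partial>M) = (\<integral>\<^sup>+k. ennreal (y ^ k) \<partial>distr M (count_space UNIV) K)"
    by (subst nn_integral_distr) auto
  also have "\<dots> = (\<integral>\<^sup>+k. ennreal (p k) * ennreal (y ^ k) \<partial>count_space UNIV)"
    unfolding distr by (subst nn_integral_density) auto
  also have "\<dots> = (\<Sum>k. ennreal (p k * y ^ k))"
    using p y by (simp add: nn_integral_count_space_nat ennreal_mult'')
  also have "\<dots> = ennreal (exp (- ((1 - y) * m)))"
    using p y sums by (subst suminf_ennreal2) (auto simp: sums_iff)
  finally have "(\<integral>\<^sup>+\<omega>. ennreal (y ^ K \<omega>) \<partial>M) = ennreal (exp (- ((1 - y) * m)))" .
  moreover have "(\<integral>\<omega>. y ^ K \<omega> \<partial>M) = enn2real (\<integral>\<^sup>+\<omega>. ennreal (y ^ K \<omega>) \<partial>M)"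
    using y by (intro integral_eq_nn_integral) auto
  ultimately show ?thesis by simp
qed

text \<open>A reproduction process may have a separate null set for each time; integer times give
  countably many, and monotonicity of the count covers the times between them.\<close>

lemma AE_locally_finite:
  assumes "reproduction_process M \<xi>"
  shows "AE \<omega> in M. locally_finite (\<xi> \<omega>)"
proof -
  from assms have meas: "\<xi> \<in> M \<rightarrow>\<^sub>M point_measure_algebra half_line"
    and fin: "\<And>t. 0 \<le> t \<Longrightarrow> AE \<omega> in M. emeasure (\<xi> \<omega>) {0..t} < \<infinity>"
    by (auto simp: reproduction_process_def)
  have "AE \<omega> in M. \<forall>n::nat. emeasure (\<xi> \<omega>) {0..real n} < \<infinity>"
    unfolding AE_all_countable using fin by simp
  with AE_space show ?thesis
  proof eventually_elim
    case (elim \<omega>)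
    have pm: "\<xi> \<omega> \<in> point_measures half_line"
      using measurable_space[OF meas elim(1)] by (simp add: space_point_measure_algebra)
    have "emeasure (\<xi> \<omega>) {0..t} < \<infinity>" for t
    proof -
      obtain n :: nat where "t \<le> real n" using real_arch_simple by blast
      then have "emeasure (\<xi> \<omega>) {0..t} \<le> emeasure (\<xi> \<omega>) {0..real n}"
        using pm interval_in_half_line by (intro emeasure_mono) (auto simp: point_measures_def)
      with elim(2) show ?thesis by (meson le_less_trans)
    qed
    with pm show ?case by (simp add: locally_finite_def)
  qed
qed

section \<open>Poisson counts in bounded sets and the Laplace functional\<close>

context
  fixes M :: "'a measure" and \<xi> :: "'a \<Rightarrow> real measure" and \<mu> :: "real measure"
  assumes pp: "poisson_point_process M \<xi> \<mu>"
begin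

lemma poisson_reproduction: "reproduction_process M \<xi>"
  using pp by (simp add: poisson_point_process_def)

lemma poisson_prob_space: "prob_space M"
  using poisson_reproduction by (simp add: reproduction_process_def)

lemma poisson_measurable_emeasure:
  assumes "B \<in> sets half_line"
  shows "(\<lambda>\<omega>. emeasure (\<xi> \<omega>) B) \<in> borel_measurable M"
  using poisson_reproduction measurable_emeasure_point_measure_algebra[OF assms]
  by (auto simp: reproduction_process_def intro: measurable_compose)

lemma sets_intensity: "sets \<mu> = sets half_line"
  using pp by (simp add: poisson_point_process_def has_intensity_def)

text \<open>Infinite intensity would put infinitely many points into a bounded interval almost
  surely, against local finiteness.\<close>

lemma intensity_finite: "emeasure \<mu> {0..t} < \<infinity>"
proof (rule ccontr)
  interpret prob_space M by (rule poisson_prob_space)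
  assume "\<not> emeasure \<mu> {0..t} < \<infinity>"
  then have "AE \<omega> in M. emeasure (\<xi> \<omega>) {0..t} = \<infinity>"
    using pp interval_in_half_line[of t] by (simp add: poisson_point_process_def not_less top_unique)
  moreover have "AE \<omega> in M. emeasure (\<xi> \<omega>) {0..t} < \<infinity>"
    using AE_locally_finite[OF poisson_reproduction] by eventually_elim (simp add: locally_finite_def)
  ultimately have "AE \<omega> in M. False" by eventually_elim simp
  then show False by simp
qed

lemma poisson_indep_vars:
  fixes I :: "nat set"
  assumes "finite I" "A ` I \<subseteq> sets half_line" "disjoint_family_on A I"
  shows "prob_space.indep_vars M (\<lambda>_. borel) (\<lambda>i \<omega>. emeasure (\<xi> \<omega>) (A i)) I"
  using pp assms unfolding poisson_point_process_def by blast

text \<open>The exponent turns the extended count into a natural number. On locally finite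
  realisations this is exact because \<open>B\<close> is bounded, so the generating function applies
  with mean \<open>measure \<mu> B\<close>.\<close>

lemma expectation_power_count:
  assumes B: "B \<in> sets half_line" "B \<subseteq> {0..t}" and y: "0 \<le> y"
  shows "(\<integral>\<omega>. y ^ nat \<lfloor>enn2real (emeasure (\<xi> \<omega>) B)\<rfloor> \<partial>M) = exp (- ((1 - y) * measure \<mu> B))"
proof (rule expectation_power_poisson[OF poisson_prob_space])
  interpret prob_space M by (rule poisson_prob_space)
  note [measurable] = poisson_measurable_emeasure[OF B(1)]
  show [measurable]: "(\<lambda>\<omega>. nat \<lfloor>enn2real (emeasure (\<xi> \<omega>) B)\<rfloor>) \<in> M \<rightarrow>\<^sub>M count_space UNIV"
    by measurable
  fix k :: nat
  have "emeasure \<mu> B \<le> emeasure \<mu> {0..t}"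
    using B interval_in_half_line by (intro emeasure_mono) (auto simp: sets_intensity)
  then have "emeasure \<mu> B < \<infinity>" using intensity_finite[of t] by (rule le_less_trans)
  then have P: "prob {\<omega>\<in>space M. emeasure (\<xi> \<omega>) B = of_nat k} =
      exp (- measure \<mu> B) * measure \<mu> B ^ k / fact k"
    using pp B by (auto simp: poisson_point_process_def)
  have "AE \<omega> in M. (nat \<lfloor>enn2real (emeasure (\<xi> \<omega>) B)\<rfloor> = k) \<longleftrightarrow> (emeasure (\<xi> \<omega>) B = of_nat k)"
    using AE_locally_finite[OF poisson_reproduction]
  proof eventually_elim
    case (elim \<omega>)
    from locally_finite_count[OF elim B] obtain n where "emeasure (\<xi> \<omega>) B = of_nat n" .
    then show ?case by (simp add: enn2real_of_nat)
  qed
  then have "prob {\<omega>\<in>space M. nat \<lfloor>enn2real (emeasure (\<xi> \<omega>) B)\<rfloor> = k} =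
      prob {\<omega>\<in>space M. emeasure (\<xi> \<omega>) B = of_nat k}"
    by (intro finite_measure_eq_AE) auto
  with P show "prob {\<omega>\<in>space M. nat \<lfloor>enn2real (emeasure (\<xi> \<omega>) B)\<rfloor> = k} =
      exp (- measure \<mu> B) * measure \<mu> B ^ k / fact k" by simp
qed (use y in auto)

text \<open>Discretising \<open>g\<close> downwards to multiples of \<open>1/(k+1)\<close> leaves finitely many level sets,
  which carry independent Poisson numbers of points.\<close>

lemma poisson_laplace_functional:
  fixes g :: "real \<Rightarrow> real" and F :: "'a \<Rightarrow> real"
  assumes g [measurable]: "g \<in> borel_measurable borel" and g01: "\<And>s. 0 \<le> g s" "\<And>s. g s \<le> 1"
    and t: "0 \<le> t"
    and F [measurable]: "F \<in> borel_measurable M"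
    and F_eq: "AE \<omega> in M. F \<omega> = (\<Prod>j\<in>points_upto (\<xi> \<omega>) t. g (enn2real (point_location (\<xi> \<omega>) j)))"
  shows "(\<integral>\<omega>. F \<omega> \<partial>M) = exp (- (\<integral>s. indicator {0..t} s * (1 - g s) \<partial>\<mu>))"
proof -
  interpret prob_space M by (rule poisson_prob_space)
  define B where "B k i = {s \<in> {0..t}. nat \<lfloor>real (Suc k) * g s\<rfloor> = i}" for k i
  define gk where "gk k s = real (nat \<lfloor>real (Suc k) * g s\<rfloor>) / real (Suc k)" for k s
  \<comment> \<open>\<open>H k\<close> is the product of \<open>gk k\<close> over the points up to
    \<open>t\<close>, with equal factors collected into powers. Levels run up to
    \<open>Suc k\<close> since \<open>g\<close> may equal 1, and an empty level contributes 1 even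
    for \<open>i = 0\<close>, as \<open>0 ^ 0 = 1\<close>.\<close>
  define H where "H k \<omega> = (\<Prod>i\<le>Suc k. (real i / real (Suc k)) ^ nat \<lfloor>enn2real (emeasure (\<xi> \<omega>) (B k i))\<rfloor>)" for k \<omega>
  have B_sets: "B k i \<in> sets half_line" for k i
  proof -
    have "B k i = {0..t} \<inter> {s \<in> space borel. nat \<lfloor>real (Suc k) * g s\<rfloor> = i}" by (auto simp: B_def)
    moreover have "{s \<in> space borel. nat \<lfloor>real (Suc k) * g s\<rfloor> = i} \<in> sets borel" by measurable
    ultimately show ?thesis by (auto simp: sets_half_line_iff)
  qed
  note [measurable] = poisson_measurable_emeasure[OF B_sets]
  have B_sub: "B k i \<subseteq> {0..t}" for k i by (auto simp: B_def)
  have gk_le: "nat \<lfloor>real (Suc k) * g s\<rfloor> \<le> Suc k" for k s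
  proof -
    have "real (Suc k) * g s \<le> real (Suc k)" using g01[of s] by (intro mult_left_le) auto
    then have "\<lfloor>real (Suc k) * g s\<rfloor> \<le> int (Suc k)" by linarith
    then show ?thesis by linarith
  qed
  have gk01: "0 \<le> gk k s" "gk k s \<le> 1" for k s
    using gk_le[of k s] by (auto simp: gk_def divide_le_eq)
  have gk_lim: "(\<lambda>k. gk k s) \<longlonglongrightarrow> g s" for s
  proof -
    have "\<bar>gk k s - g s\<bar> \<le> 1 / real (Suc k)" for k
    proof -
    have "real (nat \<lfloor>real (Suc k) * g s\<rfloor>) = of_int \<lfloor>real (Suc k) * g s\<rfloor>"
      using g01[of s] by (intro of_nat_nat) simp
    then have "\<bar>real (nat \<lfloor>real (Suc k) * g s\<rfloor>) - real (Suc k) * g s\<bar> \<le> 1"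
      by linarith
    moreover have "gk k s - g s = (real (nat \<lfloor>real (Suc k) * g s\<rfloor>) - real (Suc k) * g s) / real (Suc k)"
      by (simp add: gk_def diff_divide_distrib)
    ultimately show "\<bar>gk k s - g s\<bar> \<le> 1 / real (Suc k)"
      by (simp add: abs_divide divide_right_mono del: of_nat_Suc)
    qed
    then have "(\<lambda>k. gk k s - g s) \<longlonglongrightarrow> 0"
      by (intro Lim_null_comparison[OF _ LIMSEQ_Suc[OF lim_1_over_n]]) auto
    then show ?thesis by (simp add: LIM_zero_iff)
  qed
  have H_expect: "(\<integral>\<omega>. H k \<omega> \<partial>M) = exp (- (\<integral>s. indicator {0..t} s * (1 - gk k s) \<partial>\<mu>))" for k
  proof -
    define y where "y i = real i / real (Suc k)" for i
    define K where "K i \<omega> = y i ^ nat \<lfloor>enn2real (emeasure (\<xi> \<omega>) (B k i))\<rfloor>" for i \<omega>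
    have y: "0 \<le> y i" "i \<le> Suc k \<Longrightarrow> y i \<le> 1" for i by (auto simp: y_def divide_le_eq)
    have "disjoint_family_on (B k) {..Suc k}"
      by (auto simp: disjoint_family_on_def B_def)
    then have "indep_vars (\<lambda>_. borel) (\<lambda>i \<omega>. emeasure (\<xi> \<omega>) (B k i)) {..Suc k}"
      using B_sets by (intro poisson_indep_vars) auto
    then have ind: "indep_vars (\<lambda>_. borel) K {..Suc k}"
      unfolding K_def by (rule indep_vars_compose2) measurable
    have K_meas [measurable]: "K i \<in> borel_measurable M" for i
      unfolding K_def by measurable
    have K_int: "integrable M (K i)" if "i \<le> Suc k" for i
      using y[of i] that by (intro integrable_const_bound[of _ 1]) (auto simp: K_def power_le_one)
    have "(\<integral>\<omega>. H k \<omega> \<partial>M) = (\<Prod>i\<le>Suc k. \<integral>\<omega>. K i \<omega> \<partial>M)"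
      unfolding H_def K_def[symmetric] y_def[symmetric]
      using indep_vars_lebesgue_integral[OF _ ind K_int] by simp
    also have "\<dots> = (\<Prod>i\<le>Suc k. exp (- ((1 - y i) * measure \<mu> (B k i))))"
      unfolding K_def using y by (intro prod.cong refl expectation_power_count[OF B_sets B_sub])
    also have "\<dots> = exp (- (\<Sum>i\<le>Suc k. (1 - y i) * measure \<mu> (B k i)))"
      unfolding sum_negf[symmetric] by (rule exp_sum[symmetric]) simp
    also have "(\<Sum>i\<le>Suc k. (1 - y i) * measure \<mu> (B k i)) =
        (\<integral>s. (\<Sum>i\<le>Suc k. (1 - y i) * indicator (B k i) s) \<partial>\<mu>)"
    proof -
      have "emeasure \<mu> (B k i) < \<infinity>" for i
        using B_sub B_sets interval_in_half_line
        by (intro le_less_trans[OF emeasure_mono intensity_finite[of t]]) (auto simp: sets_intensity)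
      then show ?thesis
        using B_sets by (subst Bochner_Integration.integral_sum)
          (auto intro!: sum.cong integrable_mult_right integrable_real_indicator simp: sets_intensity less_top)
    qed
    also have "\<dots> = (\<integral>s. indicator {0..t} s * (1 - gk k s) \<partial>\<mu>)"
    proof (intro Bochner_Integration.integral_cong refl)
      fix s
      have "(1 - y i) * indicator (B k i) s =
          (if i = nat \<lfloor>real (Suc k) * g s\<rfloor> then indicator {0..t} s * (1 - gk k s) else 0)" for i
        by (auto simp: B_def y_def gk_def split: split_indicator)
      then show "(\<Sum>i\<le>Suc k. (1 - y i) * indicator (B k i) s) = indicator {0..t} s * (1 - gk k s)"
        using gk_le[of k s] by simp
    qed
    finally show ?thesis .
  qed
  have H_lim: "AE \<omega> in M. (\<lambda>k. H k \<omega>) \<longlonglongrightarrow> F \<omega>"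
    using F_eq AE_locally_finite[OF poisson_reproduction]
  proof eventually_elim
    case (elim \<omega>)
    define X where "X j = enn2real (point_location (\<xi> \<omega>) j)" for j
    define J where "J = points_upto (\<xi> \<omega>) t"
    have fin: "finite J" unfolding J_def by (rule finite_points_upto[OF elim(2) t])
    have X: "X j \<in> {0..t}" if "j \<in> J" for j
      using points_upto_location(1)[OF that[unfolded J_def] t] by (simp add: X_def)
    have "H k \<omega> = (\<Prod>j\<in>J. gk k (X j))" for k
    proof -
      have "H k \<omega> = (\<Prod>i\<le>Suc k. \<Prod>j\<in>{j\<in>J. nat \<lfloor>real (Suc k) * g (X j)\<rfloor> = i}. gk k (X j))"
        unfolding H_def
      proof (intro prod.cong refl)
        fix i
        have "emeasure (\<xi> \<omega>) (B k i) = emeasure (\<xi> \<omega>) (B k i \<inter> {0..t})"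
          using B_sub[of k i] by (simp add: Int_absorb2)
        also have "\<dots> = of_nat (card {j\<in>J. X j \<in> B k i})"
          unfolding J_def X_def using B_sets[of k i]
          by (intro emeasure_eq_card_points[OF elim(2) t]) (simp add: sets_half_line_iff)
        also have "{j\<in>J. X j \<in> B k i} = {j\<in>J. nat \<lfloor>real (Suc k) * g (X j)\<rfloor> = i}"
          using X by (auto simp: B_def)
        finally have "nat \<lfloor>enn2real (emeasure (\<xi> \<omega>) (B k i))\<rfloor> =
            card {j\<in>J. nat \<lfloor>real (Suc k) * g (X j)\<rfloor> = i}"
          by (simp add: enn2real_of_nat)
        then show "(real i / real (Suc k)) ^ nat \<lfloor>enn2real (emeasure (\<xi> \<omega>) (B k i))\<rfloor> =
            (\<Prod>j\<in>{j\<in>J. nat \<lfloor>real (Suc k) * g (X j)\<rfloor> = i}. gk k (X j))"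
          by (simp add: gk_def del: of_nat_Suc)
      qed
      also have "\<dots> = (\<Prod>j\<in>J. gk k (X j))"
        using gk_le by (intro prod.group fin) auto
      finally show ?thesis .
    qed
    then have "(\<lambda>k. H k \<omega>) \<longlonglongrightarrow> (\<Prod>j\<in>J. g (X j))"
      using gk_lim by (simp add: tendsto_prod)
    with elim(1) show ?case by (simp add: J_def X_def)
  qed
  have H_bound: "norm (H k \<omega>) \<le> 1" for k \<omega>
    unfolding H_def by (auto intro!: prod_le_1 power_le_one simp: divide_le_eq abs_prod)
  have H_meas: "H k \<in> borel_measurable M" for k
    unfolding H_def by measurable
  \<comment> \<open>Dominated convergence on both sides of \<open>H_expect\<close>: the bound is 1
    on the probability space, and under \<open>\<mu>\<close> it is the indicator of
    \<open>{0..t}\<close>, which has finite intensity.\<close>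
  have "(\<lambda>k. \<integral>\<omega>. H k \<omega> \<partial>M) \<longlonglongrightarrow> (\<integral>\<omega>. F \<omega> \<partial>M)"
    using H_lim H_bound H_meas by (intro integral_dominated_convergence[where w="\<lambda>_. 1"]) auto
  moreover have "(\<lambda>k. \<integral>\<omega>. H k \<omega> \<partial>M) \<longlonglongrightarrow> exp (- (\<integral>s. indicator {0..t} s * (1 - g s) \<partial>\<mu>))"
    unfolding H_expect
  proof (intro tendsto_intros integral_dominated_convergence[where w="indicator {0..t}"])
    have *: "h \<in> borel_measurable \<mu>" if "h \<in> borel_measurable borel" for h :: "real \<Rightarrow> real"
      using measurable_half_lineI[OF that] by (simp add: measurable_cong_sets[OF sets_intensity refl])
    show "(\<lambda>s. indicator {0..t} s * (1 - g s)) \<in> borel_measurable \<mu>"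
      by (rule *) measurable
    show "(\<lambda>s. indicator {0..t} s * (1 - gk k s)) \<in> borel_measurable \<mu>" for k
      by (rule *) (unfold gk_def, measurable)
    show "integrable \<mu> (indicator {0..t} :: real \<Rightarrow> real)"
      using interval_in_half_line[of t] intensity_finite[of t] by (simp add: sets_intensity)
    show "AE s in \<mu>. (\<lambda>k. indicator {0..t} s * (1 - gk k s)) \<longlonglongrightarrow> indicator {0..t} s * (1 - g s)"
      using gk_lim by (auto intro!: tendsto_intros)
    show "AE s in \<mu>. norm (indicator {0..t} s * (1 - gk k s)) \<le> indicator {0..t} s" for k
      using gk01[of k] by (auto split: split_indicator simp: abs_le_iff)
  qed
  ultimately show ?thesis by (rule LIMSEQ_unique)
qed

end

section \<open>Decomposition of the family tree at the root\<close>

text \<open>Reassembles a tree from the root's datum \<open>N\<close> and the trees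
  \<open>Y j\<close> of its children. The restriction to \<open>labels\<close> places the result in
  the product space, whose elements are extensional.\<close>

definition graft :: "'b \<Rightarrow> (nat \<Rightarrow> nat list \<Rightarrow> 'b) \<Rightarrow> nat list \<Rightarrow> 'b" where
  "graft N Y = (\<lambda>u\<in>labels. case u of [] \<Rightarrow> N | j # v \<Rightarrow> Y j v)"

lemma Nil_in_labels [simp]: "[] \<in> labels"
  and Cons_in_labels_iff [simp]: "j # v \<in> labels \<longleftrightarrow> 1 \<le> j \<and> v \<in> labels"
  by (auto simp: labels_def)

lemma measurable_graft:
  "(\<lambda>(N, Y). graft N Y) \<in> D \<Otimes>\<^sub>M (\<Pi>\<^sub>M j\<in>{1..}. \<Pi>\<^sub>M u\<in>labels. D) \<rightarrow>\<^sub>M (\<Pi>\<^sub>M u\<in>labels. D)"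
  unfolding graft_def split_beta'
proof (rule measurable_restrict)
  fix u :: "nat list" assume u: "u \<in> labels"
  show "(\<lambda>p. case u of [] \<Rightarrow> fst p | j # v \<Rightarrow> snd p j v)
      \<in> D \<Otimes>\<^sub>M (\<Pi>\<^sub>M j\<in>{1..}. \<Pi>\<^sub>M u\<in>labels. D) \<rightarrow>\<^sub>M D"
  proof (cases u)
    case (Cons j v)
    with u have jv: "j \<in> {1..}" "v \<in> labels" by auto
    have "(\<lambda>p. snd p j) \<in> D \<Otimes>\<^sub>M (\<Pi>\<^sub>M j\<in>{1..}. \<Pi>\<^sub>M u\<in>labels. D) \<rightarrow>\<^sub>M (\<Pi>\<^sub>M u\<in>labels. D)"
      by (rule measurable_compose[OF measurable_snd measurable_component_singleton[OF jv(1)]])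
    from measurable_compose[OF this measurable_component_singleton[OF jv(2)]]
    show ?thesis by (simp add: Cons)
  qed simp
qed

lemma prod_emb_PiE_iff:
  assumes "J \<subseteq> I"
  shows "x \<in> prod_emb I M J (Pi\<^sub>E J A) \<longleftrightarrow> x \<in> space (PiM I M) \<and> (\<forall>i\<in>J. x i \<in> A i)"
  by (auto simp: prod_emb_iff space_PiM PiE_iff)

text \<open>An i.i.d. family over all labels is an independent root together with i.i.d. trees, one
  for each first letter. On a finite cylinder the product over labels splits into the root factor
  and one block per first letter, and finite cylinders determine the product measure.\<close>

lemma distr_graft:
  fixes D :: "'b measure"
  assumes D: "prob_space D"
  shows "distr (D \<Otimes>\<^sub>M (\<Pi>\<^sub>M j\<in>{1..}. \<Pi>\<^sub>M u\<in>labels. D)) (\<Pi>\<^sub>M u\<in>labels. D) (\<lambda>(N, Y). graft N Y) =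
    (\<Pi>\<^sub>M u\<in>labels. D)" (is "distr (D \<Otimes>\<^sub>M ?P) ?T ?f = _")
proof (rule measure_eqI_PiM_infinite[symmetric, OF refl])
  interpret D: prob_space D by fact
  have T: "prob_space ?T" using D by (intro prob_space_PiM)
  interpret T: prob_space ?T by fact
  interpret P: prob_space ?P by (rule prob_space_PiM) (rule T)
  show "finite_measure ?T" by unfold_locales
  fix A :: "nat list \<Rightarrow> 'b set" and J
  assume J: "finite J" "J \<subseteq> labels" and A: "\<And>u. u \<in> J \<Longrightarrow> A u \<in> sets D"
  \<comment> \<open>\<open>J1\<close> holds the first letters occurring in \<open>J\<close>, and
    \<open>K j\<close> the remainders after the letter \<open>j\<close>. If the cylinder does not
    constrain the root, \<open>A0\<close> is the whole space.\<close>
  define J1 where "J1 = {j. \<exists>v. j # v \<in> J}"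
  define K where "K j = {v. j # v \<in> J}" for j
  define A0 where "A0 = (if [] \<in> J then A [] else space D)"
  define C where "C j = prod_emb labels (\<lambda>_. D) (K j) (\<Pi>\<^sub>E v\<in>K j. A (j # v))" for j
  let ?X = "prod_emb labels (\<lambda>_. D) J (Pi\<^sub>E J A)"
  have J1: "finite J1" "J1 \<subseteq> {1..}"
  proof -
    have "J1 \<subseteq> hd ` J" by (force simp: J1_def)
    then show "finite J1" using J(1) finite_surj by blast
    show "J1 \<subseteq> {1..}" using J(2) by (auto simp: J1_def)
  qed
  have K: "finite (K j)" "K j \<subseteq> labels" for j
  proof -
    have "K j \<subseteq> tl ` J" by (force simp: K_def)
    then show "finite (K j)" using J(1) finite_surj by blast
    show "K j \<subseteq> labels" using J(2) by (auto simp: K_def)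
  qed
  have A0: "A0 \<in> sets D" using A by (auto simp: A0_def)
  have C: "C j \<in> sets ?T" for j
    unfolding C_def using K[of j] A by (intro sets_PiM_I) (auto simp: K_def)
  have emb: "emeasure ?T ?X = (\<Prod>u\<in>J. emeasure D (A u))"
    using J A D by (intro emeasure_PiM_emb) auto
  \<comment> \<open>The preimage of the cylinder is a rectangle: a root condition times a cylinder
    over the children's trees, so its measure factors.\<close>
  have "?f -` ?X \<inter> space (D \<Otimes>\<^sub>M ?P) = A0 \<times> prod_emb {1..} (\<lambda>_. ?T) J1 (\<Pi>\<^sub>E j\<in>J1. C j)"
  proof (intro set_eqI iffI)
    fix p assume p: "p \<in> ?f -` ?X \<inter> space (D \<Otimes>\<^sub>M ?P)"
    obtain N Y where NY: "p = (N, Y)" by (cases p)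
    from p have sp: "N \<in> space D" "Y \<in> space ?P" by (auto simp: NY space_pair_measure)
    from p have u: "graft N Y u \<in> A u" if "u \<in> J" for u
      using that by (auto simp: NY prod_emb_PiE_iff[OF J(2)])
    have "N \<in> A0" using u[of "[]"] sp by (auto simp: A0_def graft_def)
    moreover have "Y j \<in> C j" if "j \<in> J1" for j
    proof -
      have "j \<in> {1..}" using that J1(2) by blast
      from measurable_space[OF measurable_component_singleton[OF this] sp(2)]
      have "Y j \<in> space ?T" .
      moreover have "Y j v \<in> A (j # v)" if "v \<in> K j" for v
        using u[of "j # v"] that J(2) by (auto simp: K_def graft_def)
      ultimately show ?thesis by (simp add: C_def prod_emb_PiE_iff[OF K(2)])
    qed
    ultimately show "p \<in> A0 \<times> prod_emb {1..} (\<lambda>_. ?T) J1 (\<Pi>\<^sub>E j\<in>J1. C j)"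
      using sp by (simp add: NY prod_emb_PiE_iff[OF J1(2)] del: One_nat_def)
  next
    fix p assume p: "p \<in> A0 \<times> prod_emb {1..} (\<lambda>_. ?T) J1 (\<Pi>\<^sub>E j\<in>J1. C j)"
    obtain N Y where NY: "p = (N, Y)" by (cases p)
    from p have sp: "N \<in> A0" "Y \<in> space ?P" and Y: "\<And>j. j \<in> J1 \<Longrightarrow> Y j \<in> C j"
      by (auto simp: NY prod_emb_PiE_iff[OF J1(2)] simp del: One_nat_def)
    have N: "N \<in> space D" using sp(1) A0 sets.sets_into_space by blast
    have "graft N Y u \<in> A u" if u: "u \<in> J" for u
    proof (cases u)
      case Nil
      with u sp(1) show ?thesis by (simp add: graft_def A0_def)
    next
      case (Cons j v)
      with u have "j \<in> J1" "v \<in> K j" by (auto simp: J1_def K_def)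
      with Y[of j] have "Y j v \<in> A (j # v)" by (simp add: C_def prod_emb_PiE_iff[OF K(2)])
      with u J(2) show ?thesis by (auto simp: Cons graft_def)
    qed
    moreover have "graft N Y \<in> space ?T"
      using measurable_space[OF measurable_graft, of "(N, Y)" D] N sp(2) by (simp add: space_pair_measure)
    ultimately show "p \<in> ?f -` ?X \<inter> space (D \<Otimes>\<^sub>M ?P)"
      using N sp by (simp add: NY space_pair_measure prod_emb_PiE_iff[OF J(2)])
  qed
  then have "emeasure (distr (D \<Otimes>\<^sub>M ?P) ?T ?f) ?X =
      emeasure (D \<Otimes>\<^sub>M ?P) (A0 \<times> prod_emb {1..} (\<lambda>_. ?T) J1 (\<Pi>\<^sub>E j\<in>J1. C j))"
    using J A by (subst emeasure_distr[OF measurable_graft]) (auto intro!: sets_PiM_I)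
  also have "\<dots> = emeasure D A0 * emeasure ?P (prod_emb {1..} (\<lambda>_. ?T) J1 (\<Pi>\<^sub>E j\<in>J1. C j))"
    using J1 A0 C by (intro P.emeasure_pair_measure_Times sets_PiM_I) auto
  also have "emeasure ?P (prod_emb {1..} (\<lambda>_. ?T) J1 (\<Pi>\<^sub>E j\<in>J1. C j)) = (\<Prod>j\<in>J1. emeasure ?T (C j))"
    using J1 C T by (intro emeasure_PiM_emb) auto
  also have "\<dots> = (\<Prod>j\<in>J1. \<Prod>v\<in>K j. emeasure D (A (j # v)))"
    unfolding C_def using K A D by (intro prod.cong refl emeasure_PiM_emb) (auto simp: K_def)
  also have "\<dots> = (\<Prod>(j, v)\<in>Sigma J1 K. emeasure D (A (j # v)))"
    using J1(1) K(1) by (intro prod.Sigma) auto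
  also have "\<dots> = (\<Prod>u\<in>J - {[]}. emeasure D (A u))"
    by (rule prod.reindex_bij_witness[where i="\<lambda>u. (hd u, tl u)" and j="\<lambda>(j, v). j # v"])
       (auto simp: J1_def K_def neq_Nil_conv)
  also have "emeasure D A0 * \<dots> = (\<Prod>u\<in>J. emeasure D (A u))"
  proof (cases "[] \<in> J")
    case True
    with J(1) show ?thesis by (simp add: A0_def prod.remove[of J "[]"])
  next
    case False
    then show ?thesis by (simp add: A0_def D.emeasure_space_1)
  qed
  finally show "emeasure ?T ?X = emeasure (distr (D \<Otimes>\<^sub>M ?P) ?T ?f) ?X"
    using emb by simp
qed simp

section \<open>Survival of the generations by a given time\<close>

definition alive :: "(nat list \<Rightarrow> real measure) \<Rightarrow> nat \<Rightarrow> real \<Rightarrow> bool" where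
  "alive \<Xi> n t \<longleftrightarrow> (\<exists>u\<in>labels. length u = n \<and> birth_time \<Xi> u \<le> ennreal t)"

definition survival :: "'a measure \<Rightarrow> ('a \<Rightarrow> real measure) \<Rightarrow> nat \<Rightarrow> real \<Rightarrow> real" where
  "survival M \<xi> n t = measure (iid_copies M \<xi>) {\<Xi> \<in> space (iid_copies M \<xi>). alive \<Xi> n t}"

lemma measurable_alive: "{\<Xi> \<in> space (iid_copies M \<xi>). alive \<Xi> n t} \<in> sets (iid_copies M \<xi>)"
proof -
  have "{\<Xi> \<in> space (iid_copies M \<xi>). birth_time \<Xi> u \<le> ennreal t} \<in> sets (iid_copies M \<xi>)"
    if "u \<in> labels" for u
  proof -
    note [measurable] = measurable_birth_time[OF that]
    show ?thesis by measurable
  qed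
  then have "(\<Union>u\<in>{u \<in> labels. length u = n}. {\<Xi> \<in> space (iid_copies M \<xi>). birth_time \<Xi> u \<le> ennreal t})
      \<in> sets (iid_copies M \<xi>)"
    by (intro sets.countable_UN'') auto
  also have "(\<Union>u\<in>{u \<in> labels. length u = n}. {\<Xi> \<in> space (iid_copies M \<xi>). birth_time \<Xi> u \<le> ennreal t}) =
      {\<Xi> \<in> space (iid_copies M \<xi>). alive \<Xi> n t}"
    by (auto simp: alive_def)
  finally show ?thesis .
qed

lemma birth_time_Cons:
  "birth_time \<Xi> (j # v) = point_location (\<Xi> []) j + birth_time (\<lambda>u. \<Xi> (j # u)) v"
  by (simp add: birth_time_def sum.lessThan_Suc_shift del: sum.lessThan_Suc)

lemma birth_time_cong:
  assumes "u \<in> labels" and "\<And>v. v \<in> labels \<Longrightarrow> \<Xi> v = \<Xi>' v"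
  shows "birth_time \<Xi> u = birth_time \<Xi>' u"
  unfolding birth_time_def using assms
  by (intro sum.cong refl arg_cong2[where f=point_location]) (auto simp: labels_def dest: in_set_takeD)

text \<open>Birth times inside the tree of child \<open>j\<close> are shifted by the location of
  \<open>j\<close>, so its descendants have only the remaining time. A child located after
  \<open>t\<close> cannot contribute, hence the subtraction only meets finite locations in
  \<open>{0..t}\<close>.\<close>

lemma alive_graft:
  assumes t: "0 \<le> t"
  shows "alive (graft N Y) (Suc n) t \<longleftrightarrow>
    (\<exists>j\<in>points_upto N t. alive (Y j) n (t - enn2real (point_location N j)))"
proof -
  have birth: "birth_time (graft N Y) (j # v) = point_location N j + birth_time (Y j) v"
    if "j # v \<in> labels" for j v
  proof -
    have "birth_time (\<lambda>u. graft N Y (j # u)) v = birth_time (Y j) v"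
      using that by (intro birth_time_cong) (auto simp: graft_def)
    then show ?thesis by (simp add: birth_time_Cons) (simp add: graft_def)
  qed
  have le: "point_location N j + b \<le> ennreal t \<longleftrightarrow>
      j \<in> points_upto N t \<and> b \<le> ennreal (t - enn2real (point_location N j))"
    if "1 \<le> j" for j b
  proof (cases "j \<in> points_upto N t")
    case True
    define x where "x = enn2real (point_location N j)"
    from points_upto_location[OF True t] have x: "0 \<le> x" "x \<le> t" "point_location N j = ennreal x"
      by (auto simp: x_def)
    have "ennreal t = ennreal x + ennreal (t - x)"
      using x by (subst ennreal_plus[symmetric]) auto
    with True show ?thesis
      unfolding x_def[symmetric] by (simp add: x(3) ennreal_add_left_cancel_le)
  next
    case False
    with that have "ennreal t < point_location N j" by (simp add: points_upto_def not_le)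
    also have "\<dots> \<le> point_location N j + b" by simp
    finally show ?thesis using False by (simp add: not_le)
  qed
  have "alive (graft N Y) (Suc n) t \<longleftrightarrow>
      (\<exists>j v. 1 \<le> j \<and> v \<in> labels \<and> length v = n \<and> point_location N j + birth_time (Y j) v \<le> ennreal t)"
  proof -
    have "alive (graft N Y) (Suc n) t \<longleftrightarrow>
        (\<exists>j v. j # v \<in> labels \<and> length v = n \<and> birth_time (graft N Y) (j # v) \<le> ennreal t)"
      unfolding alive_def Bex_def length_Suc_conv by blast
    also have "\<dots> \<longleftrightarrow> (\<exists>j v. 1 \<le> j \<and> v \<in> labels \<and> length v = n \<and>
        point_location N j + birth_time (Y j) v \<le> ennreal t)"
      using birth by (simp only: Cons_in_labels_iff) (metis (no_types, lifting))
    finally show ?thesis .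
  qed
  also have "\<dots> \<longleftrightarrow> (\<exists>j\<in>points_upto N t. alive (Y j) n (t - enn2real (point_location N j)))"
    unfolding alive_def using le by (auto simp: points_upto_def)
  finally show ?thesis .
qed

lemma survival_mono:
  assumes "reproduction_process M \<xi>" "s \<le> t"
  shows "survival M \<xi> n s \<le> survival M \<xi> n t"
proof -
  interpret prob_space "iid_copies M \<xi>" by (rule prob_space_iid_copies[OF assms(1)])
  have "ennreal s \<le> ennreal t" using assms(2) by (rule ennreal_leI)
  then show ?thesis unfolding survival_def
    by (intro finite_measure_mono measurable_alive) (auto simp: alive_def intro: order_trans)
qed

lemma survival_0:
  assumes "reproduction_process M \<xi>"
  shows "survival M \<xi> 0 t = 1"
proof -
  interpret prob_space "iid_copies M \<xi>" by (rule prob_space_iid_copies[OF assms])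
  show ?thesis by (simp add: survival_def alive_def birth_time_Nil prob_space)
qed

lemma survival_01:
  assumes "reproduction_process M \<xi>"
  shows "0 \<le> survival M \<xi> n t" "survival M \<xi> n t \<le> 1"
proof -
  interpret prob_space "iid_copies M \<xi>" by (rule prob_space_iid_copies[OF assms])
  show "0 \<le> survival M \<xi> n t" "survival M \<xi> n t \<le> 1" by (simp_all add: survival_def)
qed

text \<open>Given the root's points, the children's trees are independent, and generation
  \<open>Suc n\<close> has no member by \<open>t\<close> iff no child born by \<open>t\<close> has a
  live generation \<open>n\<close> in its remaining time. The conditional probability is thus a
  product over points, whose expectation is the Laplace functional.\<close>

lemma survival_Suc:
  assumes pp: "poisson_point_process M \<xi> \<mu>" and t: "0 \<le> t"
  shows "survival M \<xi> (Suc n) t = 1 - exp (- (\<integral>s. indicator {0..t} s * survival M \<xi> n (t - s) \<partial>\<mu>))"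
proof -
  note rp = poisson_reproduction[OF pp]
  have \<xi>: "\<xi> \<in> M \<rightarrow>\<^sub>M point_measure_algebra half_line"
    using rp by (simp add: reproduction_process_def)
  interpret M: prob_space M by (rule poisson_prob_space[OF pp])
  define D where "D = distr M (point_measure_algebra half_line) \<xi>"
  define T where "T = iid_copies M \<xi>"
  have T_eq: "T = (\<Pi>\<^sub>M u\<in>labels. D)" by (simp add: T_def D_def iid_copies_def)
  define P where "P = (\<Pi>\<^sub>M j\<in>{1::nat..}. T)"
  have D: "prob_space D" unfolding D_def using \<xi> by (rule M.prob_space_distr)
  have T: "prob_space T" unfolding T_def by (rule prob_space_iid_copies[OF rp])
  interpret T: prob_space T by fact
  interpret P: product_prob_space "\<lambda>_. T" "{1::nat..}" by unfold_locales
  have P_prob: "prob_space P" unfolding P_def by unfold_locales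
  interpret PP: prob_space P by fact
  define g where "g s = 1 - survival M \<xi> n (t - s)" for s
  have dead: "{\<Xi> \<in> space T. \<not> alive \<Xi> m s} \<in> sets T"
      "measure T {\<Xi> \<in> space T. \<not> alive \<Xi> m s} = 1 - survival M \<xi> m s" for m s
    using measurable_alive[of M \<xi> m s] T.prob_neg[of "\<lambda>\<Xi>. alive \<Xi> m s"]
    by (auto simp: T_def survival_def intro: sets.sets_Collect_neg)
  \<comment> \<open>\<open>E\<close> is the event that generation \<open>Suc n\<close> has no member
    by \<open>t\<close>, \<open>E'\<close> its preimage under grafting, and \<open>inner N\<close>
    its conditional probability given the root measure \<open>N\<close>.\<close>
  define E where "E = {\<Xi> \<in> space T. \<not> alive \<Xi> (Suc n) t}"
  define E' where "E' = (\<lambda>(N, Y). graft N Y) -` E \<inter> space (D \<Otimes>\<^sub>M P)"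
  define inner where "inner N = emeasure P (Pair N -` E')" for N
  have gr: "(\<lambda>(N, Y). graft N Y) \<in> D \<Otimes>\<^sub>M P \<rightarrow>\<^sub>M T"
    unfolding P_def T_eq by (rule measurable_graft)
  have E: "E \<in> sets T" unfolding E_def by (rule dead)
  have E': "E' \<in> sets (D \<Otimes>\<^sub>M P)" unfolding E'_def using gr E by (rule measurable_sets)
  have inner_D: "inner \<in> borel_measurable D"
    unfolding inner_def using E' by (rule PP.measurable_emeasure_Pair)
  have inner_M: "(\<lambda>\<omega>. inner (\<xi> \<omega>)) \<in> borel_measurable M"
    using inner_D \<xi> by (auto simp: D_def intro: measurable_compose)
  have inner_le: "inner N \<le> 1" for N
    unfolding inner_def by (rule PP.measure_le_1)
  have inner_eq: "inner N = (\<Prod>j\<in>points_upto N t. ennreal (g (enn2real (point_location N j))))"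
    if N: "N \<in> space D" "locally_finite N" for N
  proof -
    define C where "C j = {\<Xi> \<in> space T. \<not> alive \<Xi> n (t - enn2real (point_location N j))}" for j
    \<comment> \<open>Only finitely many children are born by \<open>t\<close>, so given
      \<open>N\<close> this is a finite cylinder in the product of the children's trees.\<close>
    have "Pair N -` E' = {Y \<in> space P. \<forall>j\<in>points_upto N t. Y j \<in> C j}"
    proof -
      have "graft N Y \<in> space T" if "Y \<in> space P" for Y
        using measurable_space[OF gr, of "(N, Y)"] that N by (simp add: space_pair_measure)
      moreover have "Y j \<in> space T" if "Y \<in> space P" "j \<in> points_upto N t" for Y j
        using that by (auto simp: P_def space_PiM points_upto_def)
      ultimately show ?thesis using N(1)
        by (auto simp: E'_def E_def C_def space_pair_measure alive_graft[OF t])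
    qed
    then have "inner N = (\<Prod>j\<in>points_upto N t. emeasure T (C j))"
      unfolding inner_def P_def using dead(1) finite_points_upto[OF N(2) t]
      by (simp only:, intro P.emeasure_PiM_Collect) (auto simp: C_def points_upto_def)
    then show ?thesis by (simp add: C_def T.emeasure_eq_measure dead(2) g_def)
  qed
  have g01: "0 \<le> g s" "g s \<le> 1" for s using survival_01[OF rp] by (auto simp: g_def)
  have g_meas: "g \<in> borel_measurable borel"
    by (intro borel_measurable_mono) (auto simp: mono_def g_def intro: survival_mono[OF rp])
  define F where "F \<omega> = enn2real (inner (\<xi> \<omega>))" for \<omega>
  have F_meas: "F \<in> borel_measurable M" unfolding F_def using inner_M by measurable
  have F_eq: "AE \<omega> in M. F \<omega> = (\<Prod>j\<in>points_upto (\<xi> \<omega>) t. g (enn2real (point_location (\<xi> \<omega>) j)))"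
    using AE_locally_finite[OF rp] AE_space
  proof eventually_elim
    case (elim \<omega>)
    then have "\<xi> \<omega> \<in> space D" using measurable_space[OF \<xi>] by (simp add: D_def)
    with elim g01 show ?case by (simp add: F_def inner_eq prod_ennreal prod_nonneg)
  qed
  have "emeasure T E = emeasure (D \<Otimes>\<^sub>M P) E'"
    unfolding E'_def using distr_graft[OF D, folded T_eq, folded P_def] emeasure_distr[OF gr E] by simp
  also have "\<dots> = (\<integral>\<^sup>+N. inner N \<partial>D)"
    unfolding inner_def using E' by (rule PP.emeasure_pair_measure_alt)
  also have "\<dots> = (\<integral>\<^sup>+\<omega>. inner (\<xi> \<omega>) \<partial>M)"
    unfolding D_def using \<xi> inner_D by (intro nn_integral_distr) (simp_all add: D_def)
  also have "\<dots> = (\<integral>\<^sup>+\<omega>. ennreal (F \<omega>) \<partial>M)"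
    unfolding F_def using inner_le by (intro nn_integral_cong) (metis ennreal_enn2real ennreal_one_less_top le_less_trans)
  finally have "emeasure T E = (\<integral>\<^sup>+\<omega>. ennreal (F \<omega>) \<partial>M)" .
  then have "measure T E = (\<integral>\<omega>. F \<omega> \<partial>M)"
    using F_meas by (subst integral_eq_nn_integral) (auto simp: F_def measure_def)
  also have "\<dots> = exp (- (\<integral>s. indicator {0..t} s * (1 - g s) \<partial>\<mu>))"
    by (rule poisson_laplace_functional[OF pp g_meas g01 t F_meas F_eq])
  finally show ?thesis using dead(2)[of "Suc n" t] by (simp add: E_def g_def)
qed

section \<open>The equation for the probability of survival\<close>

text \<open>The function \<open>q\<close> of the opening overview.\<close>

definition nonextinction :: "'a measure \<Rightarrow> ('a \<Rightarrow> real measure) \<Rightarrow> real \<Rightarrow> real" where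
  "nonextinction M \<xi> t =
     measure (iid_copies M \<xi>) {\<Xi> \<in> space (iid_copies M \<xi>). \<forall>n. alive \<Xi> n t}"

text \<open>Displacements are nonnegative, so a parent is born no later than its child; dropping
  last letters yields a witness in every earlier generation.\<close>

lemma alive_antimono:
  assumes "alive \<Xi> n t" "m \<le> n"
  shows "alive \<Xi> m t"
proof -
  have step: "alive \<Xi> k t" if k: "alive \<Xi> (Suc k) t" for k
  proof -
    from k obtain u where u: "u \<in> labels" "length u = Suc k" "birth_time \<Xi> u \<le> ennreal t"
      by (auto simp: alive_def)
    then obtain v j where v: "u = v @ [j]" by (cases u rule: rev_cases) auto
    have "birth_time \<Xi> v \<le> birth_time \<Xi> u" by (simp add: v birth_time_snoc)
    also note u(3)
    finally have "birth_time \<Xi> v \<le> ennreal t" .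
    moreover have "v \<in> labels" "length v = k" using u v by (auto simp: labels_def)
    ultimately show ?thesis unfolding alive_def by blast
  qed
  from assms(2,1) show ?thesis by (induction rule: inc_induct) (auto intro: step)
qed

lemma survival_tendsto:
  assumes "reproduction_process M \<xi>"
  shows "(\<lambda>n. survival M \<xi> n t) \<longlonglongrightarrow> nonextinction M \<xi> t"
proof -
  interpret prob_space "iid_copies M \<xi>" by (rule prob_space_iid_copies[OF assms])
  let ?A = "\<lambda>n. {\<Xi> \<in> space (iid_copies M \<xi>). alive \<Xi> n t}"
  have "decseq ?A" by (auto simp: decseq_def intro: alive_antimono)
  then have "(\<lambda>n. measure (iid_copies M \<xi>) (?A n)) \<longlonglongrightarrow> measure (iid_copies M \<xi>) (\<Inter>n. ?A n)"
    using measurable_alive by (intro finite_Lim_measure_decseq) auto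
  moreover have "(\<Inter>n. ?A n) = {\<Xi> \<in> space (iid_copies M \<xi>). \<forall>n. alive \<Xi> n t}" by auto
  ultimately show ?thesis by (simp add: survival_def nonextinction_def)
qed

lemma nonextinction_mono:
  assumes "reproduction_process M \<xi>" "s \<le> t"
  shows "nonextinction M \<xi> s \<le> nonextinction M \<xi> t"
  using LIMSEQ_le[OF survival_tendsto survival_tendsto] assms survival_mono by blast

lemma nonextinction_01:
  assumes "reproduction_process M \<xi>"
  shows "0 \<le> nonextinction M \<xi> t" "nonextinction M \<xi> t \<le> 1"
proof -
  interpret prob_space "iid_copies M \<xi>" by (rule prob_space_iid_copies[OF assms])
  show "0 \<le> nonextinction M \<xi> t" "nonextinction M \<xi> t \<le> 1" by (simp_all add: nonextinction_def)
qed

lemma nonextinction_measurable: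
  assumes "reproduction_process M \<xi>"
  shows "nonextinction M \<xi> \<in> borel_measurable borel"
  by (intro borel_measurable_mono) (auto simp: mono_def intro: nonextinction_mono[OF assms])

lemma survival_measurable:
  assumes "reproduction_process M \<xi>"
  shows "survival M \<xi> n \<in> borel_measurable borel"
  by (intro borel_measurable_mono) (auto simp: mono_def intro: survival_mono[OF assms])

section \<open>The survival equation, its largest subsolution, and positivity at all positive
  times\<close>

context
  fixes M :: "'a measure" and \<xi> :: "'a \<Rightarrow> real measure" and \<mu> :: "real measure"
  assumes pp: "poisson_point_process M \<xi> \<mu>"
begin

lemma measurable_intensityI:
  fixes f :: "real \<Rightarrow> 'c::topological_space"
  assumes "f \<in> borel_measurable borel"
  shows "f \<in> borel_measurable \<mu>"
proof -
  have "f \<in> borel_measurable half_line"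
    using assms unfolding half_line_def by (rule measurable_restrict_space1)
  then show ?thesis by (simp add: measurable_cong_sets[OF sets_intensity[OF pp] refl])
qed

lemma integrable_intensity:
  fixes f :: "real \<Rightarrow> real"
  assumes [measurable]: "f \<in> borel_measurable borel" and f01: "\<And>s. 0 \<le> f s" "\<And>s. f s \<le> 1"
    and A: "A \<in> sets borel" "A \<subseteq> {0..t}"
  shows "integrable \<mu> (\<lambda>s. indicator A s * f s)"
proof (rule Bochner_Integration.integrable_bound)
  show "integrable \<mu> (indicator {0..t} :: real \<Rightarrow> real)"
    using interval_in_half_line[of t] intensity_finite[OF pp, of t] by (simp add: sets_intensity[OF pp])
  show "(\<lambda>s. indicator A s * f s) \<in> borel_measurable \<mu>"
  proof (rule measurable_intensityI)
    note [measurable] = A(1)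
    show "(\<lambda>s. indicator A s * f s) \<in> borel_measurable borel" by measurable
  qed
  show "AE s in \<mu>. norm (indicator A s * f s) \<le> norm (indicator {0..t} s :: real)"
    using f01 A(2) by (intro AE_I2) (auto split: split_indicator)
qed

text \<open>The limit of \<open>survival_Suc\<close> over the generations, by dominated convergence
  with the indicator of \<open>{0..t}\<close> as bound.\<close>

lemma nonextinction_fixpoint:
  assumes t: "0 \<le> t"
  shows "nonextinction M \<xi> t =
    1 - exp (- (\<integral>s. indicator {0..t} s * nonextinction M \<xi> (t - s) \<partial>\<mu>))"
proof (rule LIMSEQ_unique)
  note rp = poisson_reproduction[OF pp]
  note [measurable] = nonextinction_measurable[OF rp] survival_measurable[OF rp]
  show "(\<lambda>n. survival M \<xi> (Suc n) t) \<longlonglongrightarrow> nonextinction M \<xi> t"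
    by (rule LIMSEQ_Suc[OF survival_tendsto[OF rp]])
  show "(\<lambda>n. survival M \<xi> (Suc n) t) \<longlonglongrightarrow>
      1 - exp (- (\<integral>s. indicator {0..t} s * nonextinction M \<xi> (t - s) \<partial>\<mu>))"
    unfolding survival_Suc[OF pp t]
  proof (intro tendsto_intros integral_dominated_convergence[where w="indicator {0..t}"])
    show "(\<lambda>s. indicator {0..t} s * nonextinction M \<xi> (t - s)) \<in> borel_measurable \<mu>"
      by (rule measurable_intensityI) measurable
    show "(\<lambda>s. indicator {0..t} s * survival M \<xi> n (t - s)) \<in> borel_measurable \<mu>" for n
      by (rule measurable_intensityI) measurable
    show "integrable \<mu> (indicator {0..t} :: real \<Rightarrow> real)"
      using interval_in_half_line[of t] intensity_finite[OF pp, of t] by (simp add: sets_intensity[OF pp])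
    show "AE s in \<mu>. (\<lambda>n. indicator {0..t} s * survival M \<xi> n (t - s)) \<longlonglongrightarrow>
        indicator {0..t} s * nonextinction M \<xi> (t - s)"
      using survival_tendsto[OF rp] by (auto intro!: tendsto_intros)
    show "AE s in \<mu>. norm (indicator {0..t} s * survival M \<xi> n (t - s)) \<le> indicator {0..t} s" for n
      using survival_01[OF rp, of n] by (auto split: split_indicator)
  qed
qed

text \<open>The recursion for \<open>survival\<close> is monotone and starts from the constant 1,
  which lies above \<open>f\<close>; so every iterate stays above \<open>f\<close>, and so does the
  limit. The operator at \<open>t\<close> only looks at times in \<open>{0..t}\<close>, which is why
  the inequality for \<open>f\<close> may be confined to \<open>{0..T}\<close>.\<close>

lemma subsolution_le_nonextinction:
  assumes f [measurable]: "f \<in> borel_measurable borel" and f01: "\<And>s. 0 \<le> f s" "\<And>s. f s \<le> 1"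
    and sub: "\<And>t. 0 \<le> t \<Longrightarrow> t \<le> T \<Longrightarrow> f t \<le> 1 - exp (- (\<integral>s. indicator {0..t} s * f (t - s) \<partial>\<mu>))"
    and t: "0 \<le> t" "t \<le> T"
  shows "f t \<le> nonextinction M \<xi> t"
proof -
  note rp = poisson_reproduction[OF pp]
  note [measurable] = survival_measurable[OF rp]
  have "f t \<le> survival M \<xi> n t" if "0 \<le> t" "t \<le> T" for n t
    using that
  proof (induction n arbitrary: t)
    case 0
    then show ?case by (simp add: survival_0[OF rp] f01)
  next
    case (Suc n)
    have "(\<integral>s. indicator {0..t} s * f (t - s) \<partial>\<mu>) \<le> (\<integral>s. indicator {0..t} s * survival M \<xi> n (t - s) \<partial>\<mu>)"
    proof (intro integral_mono integrable_intensity)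
      show "indicator {0..t} s * f (t - s) \<le> indicator {0..t} s * survival M \<xi> n (t - s)" for s
        using Suc by (auto split: split_indicator)
    qed (auto simp: f01 survival_01[OF rp])
    then have "1 - exp (- (\<integral>s. indicator {0..t} s * f (t - s) \<partial>\<mu>)) \<le> survival M \<xi> (Suc n) t"
      using Suc.prems by (simp add: survival_Suc[OF pp])
    with sub[OF Suc.prems] show ?case by linarith
  qed
  then show ?thesis
    using t by (intro LIMSEQ_le_const[OF survival_tendsto[OF rp]]) auto
qed

text \<open>If \<open>q(a) = 0\<close>, the shift \<open>t \<mapsto> q(t + a)\<close> is again a solution on \<open>[0, a]\<close>, so it is at most \<open>q\<close>.\<close>

lemma nonextinction_zero_double:
  assumes a: "0 \<le> a" and zero: "nonextinction M \<xi> a = 0"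
  shows "nonextinction M \<xi> (2 * a) = 0"
proof -
  note rp = poisson_reproduction[OF pp]
  note [measurable] = nonextinction_measurable[OF rp]
  note pos = nonextinction_01[OF rp]
  define f where "f t = nonextinction M \<xi> (t + a)" for t
  have "f a \<le> nonextinction M \<xi> a"
  proof (rule subsolution_le_nonextinction[where f=f and T=a])
    show "f \<in> borel_measurable borel" unfolding f_def by measurable
    fix t :: real assume t: "0 \<le> t" "t \<le> a"
    \<comment> \<open>For \<open>s\<close> beyond \<open>t\<close> the argument
      \<open>t + a - s\<close> is below \<open>a\<close>, where the nonextinction probability
      vanishes; the equation at \<open>t + a\<close> thus reduces to an integral over
      \<open>{0..t}\<close>.\<close>
    have "indicator {0..t + a} s * nonextinction M \<xi> (t + a - s) = indicator {0..t} s * f (t - s)" for s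
    proof (cases "s \<le> t")
      case True
      then show ?thesis using a by (auto simp: f_def algebra_simps split: split_indicator)
    next
      case False
      then have "nonextinction M \<xi> (t + a - s) \<le> nonextinction M \<xi> a"
        by (intro nonextinction_mono[OF rp]) simp
      with pos[of "t + a - s"] zero False show ?thesis by simp
    qed
    then show "f t \<le> 1 - exp (- (\<integral>s. indicator {0..t} s * f (t - s) \<partial>\<mu>))"
      using nonextinction_fixpoint[of "t + a"] t a by (simp add: f_def)
  qed (use pos a in \<open>auto simp: f_def\<close>)
  with pos[of "2 * a"] zero show ?thesis by (simp add: f_def)
qed

text \<open>A zero at \<open>t\<close> would propagate by doubling to every
  \<open>2 ^ n * t\<close>, hence past \<open>t0\<close>, and monotonicity would force a zero at
  \<open>t0\<close>.\<close>

lemma nonextinction_pos: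
  assumes t0: "0 < nonextinction M \<xi> t0" and t: "0 < t"
  shows "0 < nonextinction M \<xi> t"
proof (rule ccontr)
  note rp = poisson_reproduction[OF pp]
  assume "\<not> 0 < nonextinction M \<xi> t"
  then have t_zero: "nonextinction M \<xi> t = 0" using nonextinction_01(1)[OF rp, of t] by simp
  have "nonextinction M \<xi> (2 ^ n * t) = 0" for n
  proof (induction n)
    case (Suc n)
    then show ?case using nonextinction_zero_double[of "2 ^ n * t"] t by (simp add: mult.assoc)
  qed (simp add: t_zero)
  moreover obtain n where "t0 / t < 2 ^ n" using real_arch_pow[of 2 "t0 / t"] by auto
  then have "t0 \<le> 2 ^ n * t" using t by (simp add: field_simps)
  then have "nonextinction M \<xi> t0 \<le> nonextinction M \<xi> (2 ^ n * t)" by (rule nonextinction_mono[OF rp])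
  ultimately show False using t0 by simp
qed

end

section \<open>Explosion as survival of all generations\<close>

lemma measurable_locally_finite:
  "{N \<in> space (point_measure_algebra half_line). locally_finite N} \<in> sets (point_measure_algebra half_line)"
proof -
  have "locally_finite N \<longleftrightarrow> (\<forall>n::nat. emeasure N {0..real n} < \<infinity>)"
    if N: "N \<in> space (point_measure_algebra half_line)" for N
  proof -
    have "emeasure N {0..t} < \<infinity>" if fin: "\<forall>n::nat. emeasure N {0..real n} < \<infinity>" for t
    proof -
      obtain n :: nat where "t \<le> real n" using real_arch_simple by blast
      then have "emeasure N {0..t} \<le> emeasure N {0..real n}"
        using N interval_in_half_line
        by (intro emeasure_mono) (auto simp: space_point_measure_algebra point_measures_def)
      with fin show ?thesis by (meson le_less_trans)
    qed
    with N show ?thesis by (auto simp: locally_finite_def space_point_measure_algebra)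
  qed
  then have "{N \<in> space (point_measure_algebra half_line). locally_finite N} =
      {N \<in> space (point_measure_algebra half_line). \<forall>n::nat. emeasure N {0..real n} < \<infinity>}" by blast
  also have "\<dots> \<in> sets (point_measure_algebra half_line)"
  proof -
    have [measurable]: "(\<lambda>N. emeasure N {0..real n}) \<in> borel_measurable (point_measure_algebra half_line)" for n
      by (intro measurable_emeasure_point_measure_algebra interval_in_half_line)
    show ?thesis by measurable
  qed
  finally show ?thesis .
qed

text \<open>Each coordinate has the law of \<open>\<xi>\<close>, and the labels are countable, so
  the exceptional null sets can be united.\<close>

lemma AE_iid_locally_finite:
  assumes rp: "reproduction_process M \<xi>"
  shows "AE \<Xi> in iid_copies M \<xi>. \<forall>u\<in>labels. locally_finite (\<Xi> u)"
proof -
  have \<xi>: "\<xi> \<in> M \<rightarrow>\<^sub>M point_measure_algebra half_line" and M: "prob_space M"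
    using rp by (auto simp: reproduction_process_def)
  have "AE N in distr M (point_measure_algebra half_line) \<xi>. locally_finite N"
    using AE_locally_finite[OF rp] by (simp add: AE_distr_iff[OF \<xi> measurable_locally_finite])
  then have "AE \<Xi> in iid_copies M \<xi>. locally_finite (\<Xi> u)" if "u \<in> labels" for u
    unfolding iid_copies_def using that M \<xi>
    by (intro AE_PiM_component) (auto intro: prob_space.prob_space_distr)
  then show ?thesis by (subst AE_ball_countable) auto
qed

text \<open>Once generation \<open>m\<close> has no member by \<open>t\<close>, neither has any
  later one, so only generations below \<open>m\<close> count. Each of these is finite by induction,
  since an individual with a locally finite measure has finitely many children within time
  \<open>t\<close>.\<close>

lemma finite_population:
  assumes lf: "\<And>u. u \<in> labels \<Longrightarrow> locally_finite (\<Xi> u)" and t: "0 \<le> t" and dead: "\<not> alive \<Xi> m t"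
  shows "finite {u \<in> labels. birth_time \<Xi> u \<le> ennreal t}"
proof -
  define L where "L k = {u \<in> labels. length u = k \<and> birth_time \<Xi> u \<le> ennreal t}" for k
  have "finite (L k)" for k
  proof (induction k)
    case 0
    have "L 0 \<subseteq> {[]}" by (auto simp: L_def)
    then show ?case by (rule finite_subset) simp
  next
    case (Suc k)
    have "L (Suc k) \<subseteq> (\<Union>u\<in>L k. (\<lambda>j. u @ [j]) ` points_upto (\<Xi> u) t)"
    proof
      fix w assume w: "w \<in> L (Suc k)"
      then obtain u j where u: "w = u @ [j]" by (cases w rule: rev_cases) (auto simp: L_def)
      from w have le: "birth_time \<Xi> u + point_location (\<Xi> u) j \<le> ennreal t"
        by (simp add: L_def u birth_time_snoc)
      have "birth_time \<Xi> u \<le> ennreal t" "point_location (\<Xi> u) j \<le> ennreal t"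
        by (rule order_trans[OF _ le], simp)+
      with w have "u \<in> L k" "j \<in> points_upto (\<Xi> u) t"
        by (auto simp: L_def u labels_def points_upto_def)
      then show "w \<in> (\<Union>u\<in>L k. (\<lambda>j. u @ [j]) ` points_upto (\<Xi> u) t)"
        unfolding u by blast
    qed
    moreover have "finite (points_upto (\<Xi> u) t)" if "u \<in> L k" for u
      using that lf t by (intro finite_points_upto) (auto simp: L_def)
    ultimately show ?case using Suc by (meson finite_UN_I finite_imageI finite_subset)
  qed
  moreover have "{u \<in> labels. birth_time \<Xi> u \<le> ennreal t} \<subseteq> (\<Union>k<m. L k)"
  proof
    fix u assume u: "u \<in> {u \<in> labels. birth_time \<Xi> u \<le> ennreal t}"
    then have "alive \<Xi> (length u) t" by (auto simp: alive_def)
    with dead have "length u < m" using alive_antimono not_le by blast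
    with u show "u \<in> (\<Union>k<m. L k)" by (auto simp: L_def)
  qed
  ultimately show ?thesis by (meson finite_UN_I finite_lessThan finite_subset)
qed

text \<open>By \<open>finite_population\<close>, an infinite population has members in every
  generation; conversely, members in every generation have labels of every length. Integer times
  prepare a countable union of events.\<close>

lemma explosion_iff_alive:
  assumes lf: "\<And>u. u \<in> labels \<Longrightarrow> locally_finite (\<Xi> u)"
  shows "explosion_time \<Xi> < \<infinity> \<longleftrightarrow> (\<exists>n::nat. \<forall>m. alive \<Xi> m (real n))"
proof
  assume "explosion_time \<Xi> < \<infinity>"
  then obtain t where t: "0 \<le> t" "population \<Xi> t = \<infinity>"
    by (auto simp: explosion_time_def INF_less_iff)
  obtain n :: nat where n: "t \<le> real n" using real_arch_simple by blast
  from t(2) have "infinite {u \<in> labels. birth_time \<Xi> u \<le> ennreal t}"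
    by (auto simp: population_def emeasure_count_space)
  with finite_population[of \<Xi> t] lf t(1) have "\<forall>m. alive \<Xi> m t" by blast
  then show "\<exists>n::nat. \<forall>m. alive \<Xi> m (real n)"
    using ennreal_leI[OF n] unfolding alive_def by (meson order_trans)
next
  assume "\<exists>n::nat. \<forall>m. alive \<Xi> m (real n)"
  then obtain n :: nat where n: "\<And>m. alive \<Xi> m (real n)" by blast
  have "infinite {u \<in> labels. birth_time \<Xi> u \<le> ennreal (real n)}"
  proof
    assume "finite {u \<in> labels. birth_time \<Xi> u \<le> ennreal (real n)}"
    then have "finite (length ` {u \<in> labels. birth_time \<Xi> u \<le> ennreal (real n)})" by simp
    moreover have "m \<in> length ` {u \<in> labels. birth_time \<Xi> u \<le> ennreal (real n)}" for m
      using n[of m] by (auto simp: alive_def simp del: ennreal_of_nat_eq_real_of_nat)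
    then have "length ` {u \<in> labels. birth_time \<Xi> u \<le> ennreal (real n)} = UNIV" by blast
    ultimately show False by simp
  qed
  then have "population \<Xi> (real n) = \<infinity>"
    by (auto simp: population_def emeasure_count_space)
  then show "explosion_time \<Xi> < \<infinity>"
    by (auto simp: explosion_time_def INF_less_iff intro!: exI[of _ "real n"])
qed

text \<open>Almost surely, explosion is the union over integer times of the events that all
  generations survive, and a countable union has positive probability iff one of its members
  does.\<close>

lemma explosive_iff:
  assumes rp: "reproduction_process M \<xi>"
  shows "explosive M \<xi> \<longleftrightarrow> (\<exists>n::nat. 0 < nonextinction M \<xi> (real n))"
proof -
  interpret prob_space "iid_copies M \<xi>" by (rule prob_space_iid_copies[OF rp])
  let ?I = "iid_copies M \<xi>"
  let ?A = "\<lambda>n::nat. {\<Xi> \<in> space ?I. \<forall>m. alive \<Xi> m (real n)}"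
  have A: "?A n \<in> events" for n
  proof -
    have "?A n = (\<Inter>m. {\<Xi> \<in> space ?I. alive \<Xi> m (real n)})" by auto
    also have "\<dots> \<in> events" by (intro sets.countable_INT) (auto simp: measurable_alive)
    finally show ?thesis .
  qed
  have "AE \<Xi> in ?I. \<Xi> \<in> {\<Xi> \<in> space ?I. explosion_time \<Xi> < \<infinity>} \<longleftrightarrow> \<Xi> \<in> (\<Union>n. ?A n)"
    using AE_iid_locally_finite[OF rp] by eventually_elim (use explosion_iff_alive in auto)
  then have eq: "prob {\<Xi> \<in> space ?I. explosion_time \<Xi> < \<infinity>} = prob (\<Union>n. ?A n)"
    using A measurable_explosion by (intro finite_measure_eq_AE) auto
  have "prob (\<Union>n. ?A n) = 0 \<longleftrightarrow> (\<forall>n. prob (?A n) = 0)"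
  proof
    assume zero: "prob (\<Union>n. ?A n) = 0"
    show "\<forall>n. prob (?A n) = 0"
    proof
      fix n
      have "prob (?A n) \<le> prob (\<Union>n. ?A n)"
        using A by (intro finite_measure_mono) auto
      with zero show "prob (?A n) = 0" using measure_nonneg[of ?I "?A n"] by linarith
    qed
  next
    assume "\<forall>n. prob (?A n) = 0"
    then have "?A n \<in> null_sets ?I" for n
      using A by (intro null_setsI) (simp_all add: emeasure_eq_measure)
    then have "(\<Union>n. ?A n) \<in> null_sets ?I" by (rule null_sets_UN)
    then show "prob (\<Union>n. ?A n) = 0" unfolding measure_def by (simp only: null_setsD1 enn2real_0)
  qed
  then show ?thesis
    unfolding explosive_def eq nonextinction_def by (simp add: zero_less_measure_iff)
qed

section \<open>Comparison of two intensities\<close>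

text \<open>With \<open>a\<close> its supremum, a nonempty down-closed \<open>S\<close> is either
  \<open>{0<..a}\<close>, where the hypothesis applies directly, or \<open>{0<..<a}\<close>, an
  increasing union of intervals to which it applies.\<close>

lemma emeasure_downset_le:
  fixes \<mu> \<mu>' :: "real measure"
  assumes sets: "sets \<mu> = sets half_line" "sets \<mu>' = sets half_line"
    and le: "\<And>s. 0 < s \<Longrightarrow> s \<le> t \<Longrightarrow> emeasure \<mu> {0<..s} \<le> C * emeasure \<mu>' {0<..s}"
    and S: "S \<subseteq> {0<..t}" "\<And>x y. x \<in> S \<Longrightarrow> 0 < y \<Longrightarrow> y \<le> x \<Longrightarrow> y \<in> S" "S \<in> sets half_line"
  shows "emeasure \<mu> S \<le> C * emeasure \<mu>' S"
proof (cases "S = {}")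
  case False
  then obtain x0 where x0: "x0 \<in> S" by blast
  have Ioc: "{0<..s} \<in> sets half_line" for s by (auto simp: sets_half_line_iff)
  have bdd: "bdd_above S" using S(1) by (auto intro!: bdd_aboveI[of _ t])
  define a where "a = Sup S"
  have x0_le: "0 < x0" "x0 \<le> a" using x0 S(1) cSup_upper[OF x0 bdd] by (auto simp: a_def)
  have a_le: "a \<le> t" unfolding a_def using False S(1) by (intro cSup_least) auto
  have mem: "y \<in> S" if y: "0 < y" "y < a" for y
    using less_cSupD[OF False y(2)[unfolded a_def]] S(2) y(1) by force
  have S_le: "y \<le> a" "0 < y" if "y \<in> S" for y
    using cSup_upper[OF that bdd] that S(1) by (auto simp: a_def)
  show ?thesis
  proof (cases "a \<in> S")
    case True
    have "S = {0<..a}" using S_le S(2)[OF True] by auto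
    then show ?thesis using le[of a] x0_le a_le by simp
  next
    case False
    \<comment> \<open>The denominator \<open>n + 2\<close> keeps the right end point strictly
      between 0 and \<open>a\<close> already for \<open>n = 0\<close>, as the hypothesis asks for a
      positive \<open>s\<close>.\<close>
    define I where "I n = {0<..a - a / real (Suc (Suc n))}" for n
    have I_bounds: "0 < a - a / real (Suc (Suc n))" "a - a / real (Suc (Suc n)) < a" for n
      using x0_le by (auto simp: field_simps intro: add_pos_nonneg)
    have "S = (\<Union>n. I n)"
    proof (intro equalityI subsetI)
      fix y assume y: "y \<in> S"
      then have ya: "0 < y" "y < a" using S_le[OF y] False by (auto simp: order_less_le)
      obtain n where n: "a / (a - y) < real n" using reals_Archimedean2 by blast
      have "a < real n * (a - y)" using n ya by (simp add: divide_less_eq)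
      also have "\<dots> \<le> real (Suc (Suc n)) * (a - y)" using ya by (intro mult_right_mono) auto
      finally have "a / real (Suc (Suc n)) \<le> a - y"
        by (simp add: divide_le_eq mult.commute del: of_nat_Suc)
      then have "y \<in> I n" using ya by (simp add: I_def)
      then show "y \<in> (\<Union>n. I n)" by blast
    next
      fix y assume "y \<in> (\<Union>n. I n)"
      then obtain n where "0 < y" "y \<le> a - a / real (Suc (Suc n))" by (auto simp: I_def)
      with I_bounds(2)[of n] show "y \<in> S" by (intro mem) auto
    qed
    moreover have "incseq I"
      unfolding incseq_Suc_iff
    proof
      fix n
      have "a / real (Suc (Suc (Suc n))) \<le> a / real (Suc (Suc n))"
        using x0_le by (intro divide_left_mono) auto
      then show "I n \<subseteq> I (Suc n)" unfolding I_def unfolding Ioc_subset_iff by linarith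
    qed
    ultimately have "emeasure \<mu> S = (SUP n. emeasure \<mu> (I n))"
      using Ioc by (subst SUP_emeasure_incseq) (auto simp: I_def sets)
    also have "\<dots> \<le> C * emeasure \<mu>' S"
    proof (rule SUP_least)
      fix n
      have "emeasure \<mu> (I n) \<le> C * emeasure \<mu>' (I n)"
        unfolding I_def using I_bounds[of n] a_le by (intro le) auto
      also have "\<dots> \<le> C * emeasure \<mu>' S"
        using \<open>S = (\<Union>n. I n)\<close> S(3) by (intro mult_left_mono emeasure_mono) (auto simp: sets)
      finally show "emeasure \<mu> (I n) \<le> C * emeasure \<mu>' S" .
    qed
    finally show ?thesis .
  qed
qed simp

text \<open>Tonelli for the region below the graph of \<open>h\<close>. The condition
  \<open>0 \<le> x\<close> discards negative levels, matching \<open>ennreal (h s) = 0\<close> for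
  negative \<open>h s\<close>. The second claim allows a constant to be moved out of the integral
  over levels.\<close>

lemma nn_integral_layer_cake:
  fixes \<nu> :: "real measure" and h :: "real \<Rightarrow> real"
  assumes sets: "sets \<nu> = sets half_line" and sf: "sigma_finite_measure \<nu>"
    and h: "h \<in> borel_measurable borel"
  shows "(\<integral>\<^sup>+s. indicator {0<..t} s * ennreal (h s) \<partial>\<nu>) =
      (\<integral>\<^sup>+x. emeasure \<nu> {s \<in> {0<..t}. 0 \<le> x \<and> x < h s} \<partial>lborel)"
    and "(\<lambda>x. emeasure \<nu> {s \<in> {0<..t}. 0 \<le> x \<and> x < h s}) \<in> borel_measurable lborel"
proof -
  interpret sigma_finite_measure \<nu> by fact
  interpret pair_sigma_finite \<nu> lborel ..
  have [measurable]: "h \<in> borel_measurable \<nu>" "Measurable.pred \<nu> (\<lambda>s. s \<in> {0<..t})"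
    using measurable_half_lineI[OF h] measurable_restrict_space1[of "\<lambda>s::real. s \<in> {0<..t}" borel "count_space UNIV" "{0..}"]
    by (simp_all add: measurable_cong_sets[OF sets refl] half_line_def[symmetric])
  define f where "f s x = (indicator {p. fst p \<in> {0<..t} \<and> 0 \<le> snd p \<and> snd p < h (fst p)} (s, x) :: ennreal)" for s x
  have space: "space \<nu> = {0..}"
    using sets_eq_imp_space_eq[OF sets] by (simp add: half_line_def space_restrict_space)
  have f_meas: "case_prod f \<in> borel_measurable (\<nu> \<Otimes>\<^sub>M lborel)"
    unfolding f_def split_beta' prod.collapse by measurable
  have "(\<integral>\<^sup>+s. indicator {0<..t} s * ennreal (h s) \<partial>\<nu>) = (\<integral>\<^sup>+s. \<integral>\<^sup>+x. f s x \<partial>lborel \<partial>\<nu>)"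
  proof (rule nn_integral_cong)
    fix s
    have "(\<integral>\<^sup>+x. f s x \<partial>lborel) = (\<integral>\<^sup>+x. indicator {0<..t} s * indicator {0..<h s} x \<partial>lborel)"
      by (intro nn_integral_cong) (auto simp: f_def split: split_indicator)
    also have "\<dots> = indicator {0<..t} s * emeasure lborel {0..<h s}"
      by (simp add: nn_integral_cmult)
    also have "emeasure lborel {0..<h s} = ennreal (h s)"
      by (cases "0 \<le> h s") (auto simp: ennreal_neg)
    finally show "indicator {0<..t} s * ennreal (h s) = (\<integral>\<^sup>+x. f s x \<partial>lborel)" ..
  qed
  also have "\<dots> = (\<integral>\<^sup>+x. \<integral>\<^sup>+s. f s x \<partial>\<nu> \<partial>lborel)"
    using f_meas by (rule Fubini'[symmetric])
  finally have fubini: "(\<integral>\<^sup>+s. indicator {0<..t} s * ennreal (h s) \<partial>\<nu>) = (\<integral>\<^sup>+x. \<integral>\<^sup>+s. f s x \<partial>\<nu> \<partial>lborel)" .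
  have layer: "(\<integral>\<^sup>+s. f s x \<partial>\<nu>) = emeasure \<nu> {s \<in> {0<..t}. 0 \<le> x \<and> x < h s}" for x
  proof -
    have "{s \<in> space \<nu>. s \<in> {0<..t} \<and> 0 \<le> x \<and> x < h s} \<in> sets \<nu>" by measurable
    moreover have "{s \<in> space \<nu>. s \<in> {0<..t} \<and> 0 \<le> x \<and> x < h s} = {s \<in> {0<..t}. 0 \<le> x \<and> x < h s}"
      by (auto simp: space)
    moreover have "(\<lambda>s. f s x) = indicator {s \<in> {0<..t}. 0 \<le> x \<and> x < h s}"
      by (auto simp: f_def split: split_indicator)
    ultimately show ?thesis by (simp add: nn_integral_indicator)
  qed
  show "(\<integral>\<^sup>+s. indicator {0<..t} s * ennreal (h s) \<partial>\<nu>) =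
      (\<integral>\<^sup>+x. emeasure \<nu> {s \<in> {0<..t}. 0 \<le> x \<and> x < h s} \<partial>lborel)"
    by (simp only: fubini layer)
  have "(\<lambda>(x, s). f s x) \<in> borel_measurable (lborel \<Otimes>\<^sub>M \<nu>)"
    using measurable_compose[OF measurable_pair_swap' f_meas] by (simp add: split_beta')
  then have "(\<lambda>x. \<integral>\<^sup>+s. f s x \<partial>\<nu>) \<in> borel_measurable lborel"
    by (rule sigma_finite_measure.borel_measurable_nn_integral[OF sf, where f="\<lambda>x s. f s x"])
  then show "(\<lambda>x. emeasure \<nu> {s \<in> {0<..t}. 0 \<le> x \<and> x < h s}) \<in> borel_measurable lborel"
    by (simp only: layer)
qed

text \<open>The superlevel sets of a decreasing function are down-closed in \<open>{0<..t}\<close>,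
  so \<open>emeasure_downset_le\<close> compares the measures level by level and the layer-cake
  formula integrates the result.\<close>

lemma nn_integral_antimono_le:
  fixes \<mu> \<mu>' :: "real measure" and h :: "real \<Rightarrow> real"
  assumes sets: "sets \<mu> = sets half_line" "sets \<mu>' = sets half_line"
    and sf: "sigma_finite_measure \<mu>" "sigma_finite_measure \<mu>'"
    and le: "\<And>s. 0 < s \<Longrightarrow> s \<le> t \<Longrightarrow> emeasure \<mu> {0<..s} \<le> C * emeasure \<mu>' {0<..s}"
    and h: "antimono h"
  shows "(\<integral>\<^sup>+s. indicator {0<..t} s * ennreal (h s) \<partial>\<mu>) \<le> C * (\<integral>\<^sup>+s. indicator {0<..t} s * ennreal (h s) \<partial>\<mu>')"
proof -
  have h_meas: "h \<in> borel_measurable borel"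
  proof -
    have "(\<lambda>s. - h s) \<in> borel_measurable borel"
      using h by (intro borel_measurable_mono) (auto simp: mono_def antimono_def)
    then show ?thesis by simp
  qed
  let ?S = "\<lambda>x. {s \<in> {0<..t}. 0 \<le> x \<and> x < h s}"
  have S_sets: "?S x \<in> sets half_line" for x
  proof -
    note [measurable] = h_meas
    have "{s \<in> space borel. 0 \<le> x \<and> x < h s} \<in> sets borel" by measurable
    then have "{0<..t} \<inter> {s \<in> space borel. 0 \<le> x \<and> x < h s} \<in> sets half_line"
      unfolding sets_half_line_iff by (intro conjI sets.Int) auto
    also have "{0<..t} \<inter> {s \<in> space borel. 0 \<le> x \<and> x < h s} = ?S x" by auto
    finally show ?thesis .
  qed
  have S_meas: "(\<lambda>x. emeasure \<mu>' (?S x)) \<in> borel_measurable lborel"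
    by (rule nn_integral_layer_cake(2)[OF sets(2) sf(2) h_meas])
  have "(\<integral>\<^sup>+x. emeasure \<mu> (?S x) \<partial>lborel) \<le> (\<integral>\<^sup>+x. C * emeasure \<mu>' (?S x) \<partial>lborel)"
  proof (rule nn_integral_mono)
    fix x :: real
    show "emeasure \<mu> (?S x) \<le> C * emeasure \<mu>' (?S x)"
    proof (rule emeasure_downset_le[OF sets le])
      fix s y assume "s \<in> ?S x" "0 < y" "y \<le> s"
      then show "y \<in> ?S x" using antimonoD[OF h, of y s] by auto
    qed (use S_sets in auto)
  qed
  also have "\<dots> = C * (\<integral>\<^sup>+x. emeasure \<mu>' (?S x) \<partial>lborel)"
    using S_meas by (rule nn_integral_cmult)
  finally show ?thesis
    unfolding nn_integral_layer_cake(1)[OF sets(1) sf(1) h_meas] nn_integral_layer_cake(1)[OF sets(2) sf(2) h_meas] .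
qed

text \<open>The equation \<open>q = 1 - exp (- (q + A))\<close> reads \<open>h(q) = A\<close> for \<open>h(x) = - ln (1 - x) - x\<close>. As \<open>h\<close>
  vanishes to second order at \<open>0\<close>, scaling \<open>q\<close> down by \<open>C\<close> gains a factor \<open>C\<^sup>2\<close> on the left and
  loses only \<open>C\<close> on the right.\<close>

lemma neg_log_remainder_scale:
  fixes c x :: real
  assumes c: "0 \<le> c" "c \<le> 1" and x: "0 \<le> x" "x < 1"
  shows "- ln (1 - c * x) - c * x \<le> c\<^sup>2 * (- ln (1 - x) - x)"
proof -
  \<comment> \<open>The difference of the two sides vanishes at 0, and its derivative is nonnegative
    because \<open>c * y \<le> y\<close>.\<close>
  define F where "F y = c\<^sup>2 * (- ln (1 - y) - y) - (- ln (1 - c * y) - c * y)" for y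
  have "F 0 \<le> F x"
  proof (rule DERIV_nonneg_imp_nondecreasing[OF x(1)])
    fix y assume y: "0 \<le> y" "y \<le> x"
    have cy: "c * y \<le> y" using c y by (simp add: mult_left_le_one_le)
    have "c * y < 1" using cy y x by linarith
    have "(F has_real_derivative (c\<^sup>2 * (1 / (1 - y) - 1) - (c / (1 - c * y) - c))) (at y)"
      unfolding F_def using y x \<open>c * y < 1\<close> by (auto intro!: derivative_eq_intros simp: divide_inverse)
    moreover have "c\<^sup>2 * (1 / (1 - y) - 1) - (c / (1 - c * y) - c) = c\<^sup>2 * y * (1 / (1 - y) - 1 / (1 - c * y))"
      using y x \<open>c * y < 1\<close> by (simp add: field_simps power2_eq_square)
    moreover have "1 / (1 - c * y) \<le> 1 / (1 - y)"
      using cy y x by (intro divide_left_mono) auto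
    ultimately show "\<exists>d. (F has_real_derivative d) (at y) \<and> 0 \<le> d" using y by force
  qed
  then show ?thesis by (simp add: F_def)
qed

text \<open>The equation for \<open>q\<close> says that \<open>- ln (1 - q) - q\<close> equals
  \<open>A\<close>. With \<open>c = 1 / C\<close>, the same expression at \<open>c * q\<close> is at
  most \<open>c\<^sup>2 * A \<le> c\<^sup>2 * (C * A') = c * A'\<close>; exponentiating gives the
  claim.\<close>

lemma scaled_subsolution:
  fixes q A A' C :: real
  assumes q: "0 \<le> q" and fix_eq: "q = 1 - exp (- (q + A))" and A: "A \<le> C * A'" and C: "1 \<le> C"
  shows "q / C \<le> 1 - exp (- (q / C + A' / C))"
proof -
  define c where "c = 1 / C"
  have c: "0 < c" "c \<le> 1" using C by (auto simp: c_def)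
  have q1: "q < 1" using fix_eq exp_gt_zero[of "- (q + A)"] by linarith
  have "ln (1 - q) = - (q + A)" using fix_eq by (metis add_diff_cancel_left' diff_add_cancel ln_exp)
  then have A_eq: "- ln (1 - q) - q = A" by simp
  have cq: "c * q < 1" using mult_left_le_one_le[of q c] q q1 c by linarith
  have "- ln (1 - c * q) - c * q \<le> c\<^sup>2 * A"
    using neg_log_remainder_scale[of c q] c q q1 A_eq by simp
  also have "\<dots> \<le> c\<^sup>2 * (C * A')" using A by (intro mult_left_mono) auto
  also have "\<dots> = c * A'" using C by (simp add: c_def power2_eq_square)
  finally have "- (c * q + c * A') \<le> ln (1 - c * q)" by simp
  then have "exp (- (c * q + c * A')) \<le> exp (ln (1 - c * q))" by simp
  with cq have "exp (- (c * q + c * A')) \<le> 1 - c * q" by simp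
  then show ?thesis by (simp add: c_def)
qed

section \<open>The contribution of the unit atom at zero\<close>

context
  fixes M :: "'a measure" and \<xi> :: "'a \<Rightarrow> real measure" and \<mu> :: "real measure"
  assumes pp: "poisson_point_process M \<xi> \<mu>"
begin

lemma sigma_finite_intensity: "sigma_finite_measure \<mu>"
proof
  have space: "space \<mu> = {0..}"
    using sets_eq_imp_space_eq[OF sets_intensity[OF pp]] by (simp add: half_line_def space_restrict_space)
  show "\<exists>A. countable A \<and> A \<subseteq> sets \<mu> \<and> \<Union> A = space \<mu> \<and> (\<forall>a\<in>A. emeasure \<mu> a \<noteq> \<infinity>)"
  proof (intro exI[of _ "range (\<lambda>n::nat. {0..real n})"] conjI)
    show "\<Union> (range (\<lambda>n::nat. {0..real n})) = space \<mu>"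
      using real_arch_simple by (force simp: space)
  qed (use interval_in_half_line intensity_finite[OF pp] in \<open>auto simp: sets_intensity[OF pp] less_top\<close>)
qed

text \<open>The atom of mass 1 contributes \<open>f t\<close> itself. This is the linear term that
  cancels the first-order part of \<open>- ln (1 - x)\<close>; the integral over
  \<open>{0<..t}\<close> plays the role of \<open>A\<close> in
  \<open>scaled_subsolution\<close>.\<close>

lemma integral_split_atom:
  fixes f :: "real \<Rightarrow> real"
  assumes atom: "emeasure \<mu> {0} = 1" and t: "0 \<le> t"
    and f: "f \<in> borel_measurable borel" "\<And>s. 0 \<le> f s" "\<And>s. f s \<le> 1"
  shows "(\<integral>s. indicator {0..t} s * f (t - s) \<partial>\<mu>) = f t + (\<integral>s. indicator {0<..t} s * f (t - s) \<partial>\<mu>)"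
proof -
  note [measurable] = f(1)
  have f_meas: "(\<lambda>s. f (t - s)) \<in> borel_measurable borel" by measurable
  have "(\<integral>s. indicator {0..t} s * f (t - s) \<partial>\<mu>) =
      (\<integral>s. indicator {0} s * f (t - s) + indicator {0<..t} s * f (t - s) \<partial>\<mu>)"
    using t by (intro Bochner_Integration.integral_cong) (auto split: split_indicator)
  also have "\<dots> = (\<integral>s. indicator {0} s * f (t - s) \<partial>\<mu>) + (\<integral>s. indicator {0<..t} s * f (t - s) \<partial>\<mu>)"
    using t f by (intro Bochner_Integration.integral_add integrable_intensity[OF pp f_meas, where t=t]) auto
  also have "(\<integral>s. indicator {0} s * f (t - s) \<partial>\<mu>) = (\<integral>s. indicator {0} s * f t \<partial>\<mu>)"
    by (intro Bochner_Integration.integral_cong) (auto split: split_indicator)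
  also have "\<dots> = measure \<mu> {0} * f t"
    using sets_eq_imp_space_eq[OF sets_intensity[OF pp]] by (simp add: half_line_def space_restrict_space)
  also have "measure \<mu> {0} = 1" using atom by (simp add: measure_def)
  finally show ?thesis by simp
qed

end

section \<open>Transfer of explosion to the second process\<close>

lemma Limsup_quotient_bound:
  fixes a b :: "real \<Rightarrow> ennreal"
  assumes lim: "Limsup (at_right 0) (\<lambda>t. a t / b t) < \<infinity>" and b: "\<And>t. 0 < t \<Longrightarrow> 0 < b t"
    and b_fin: "\<And>t. b t < \<infinity>"
  obtains C t0 :: real where "1 \<le> C" "0 < t0" "\<And>t. 0 < t \<Longrightarrow> t \<le> t0 \<Longrightarrow> a t \<le> ennreal C * b t"
proof -
  obtain D where D: "Limsup (at_right 0) (\<lambda>t. a t / b t) < D" "D < \<infinity>" using dense[OF lim] by blast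
  from Limsup_lessD[OF D(1)] obtain d where d: "0 < d" "\<And>t. 0 < t \<Longrightarrow> t < d \<Longrightarrow> a t / b t < D"
    by (auto simp: eventually_at_right_field)
  \<comment> \<open>The maximum with 1 later keeps \<open>q / C\<close> at most 1 and makes
    \<open>1 / C\<close> an admissible scaling factor.\<close>
  define C where "C = max 1 (enn2real D)"
  show thesis
  proof (rule that[of C "d / 2"])
    fix t :: real assume t: "0 < t" "t \<le> d / 2"
    \<comment> \<open>Cancelling in \<open>ennreal\<close> is legitimate because \<open>b t\<close>
      is neither 0 nor infinite.\<close>
    have "a t = a t / b t * b t"
      using b[OF t(1)] b_fin[of t] by (simp add: ennreal_divide_times zero_less_iff_neq_zero)
    also have "\<dots> \<le> D * b t" using d(2)[of t] d(1) t by (intro mult_right_mono) auto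
    also have "D = ennreal (enn2real D)" using D(2) by simp
    also have "\<dots> \<le> ennreal C" by (intro ennreal_leI) (simp add: C_def)
    finally show "a t \<le> ennreal C * b t" by (simp add: mult_right_mono)
  qed (use d in \<open>auto simp: C_def\<close>)
qed

theorem corollary5p5:
  fixes M :: "'a measure" and M' :: "'b measure"
    and \<xi> :: "'a \<Rightarrow> real measure" and \<xi>' :: "'b \<Rightarrow> real measure"
    and \<mu> \<mu>' :: "real measure"
  assumes "poisson_point_process M \<xi> \<mu>"
    and "poisson_point_process M' \<xi>' \<mu>'"
    and "emeasure \<mu> {0} = 1" and "emeasure \<mu>' {0} = 1"
    and "\<And>t. t > 0 \<Longrightarrow> emeasure \<mu> {0<..t} > 0"
    and "\<And>t. t > 0 \<Longrightarrow> emeasure \<mu>' {0<..t} > 0"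
    and "\<exists>\<phi> :: real \<Rightarrow> real.
           (\<forall>r\<ge>0. \<phi> r \<ge> 0) \<and>
           (\<phi> \<longlongrightarrow> 0) (at_right 0) \<and>
           Limsup (at (0, 0) within {0<..} \<times> {0<..})
             (\<lambda>(t, r). extended_quotient (emeasure \<mu>' {0<..r * t}) (ennreal (\<phi> r) * emeasure \<mu>' {0<..t})) < \<infinity>"
    and "Limsup (at_right 0) (\<lambda>t. emeasure \<mu> {0<..t} / emeasure \<mu>' {0<..t}) < \<infinity>"
    and "explosive M \<xi>"
  shows "explosive M' \<xi>'"
proof -
  note pp = assms(1) and pp' = assms(2)
  note rp = poisson_reproduction[OF pp] and rp' = poisson_reproduction[OF pp']
  note [measurable] = nonextinction_measurable[OF rp]
  define q where "q = nonextinction M \<xi>"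
  have q: "q \<in> borel_measurable borel" "\<And>s. 0 \<le> q s" "\<And>s. q s \<le> 1"
    using nonextinction_01[OF rp] by (simp_all add: q_def nonextinction_measurable[OF rp])
  have Ioc_fin: "emeasure \<mu>' {0<..t} < \<infinity>" for t
    using interval_in_half_line
    by (intro le_less_trans[OF emeasure_mono intensity_finite[OF pp', of t]]) (auto simp: sets_intensity[OF pp'])
  from Limsup_quotient_bound[OF assms(8,6) Ioc_fin]
  obtain C t0 :: real where C: "1 \<le> C" and t0: "0 < t0"
    and le: "\<And>t. 0 < t \<Longrightarrow> t \<le> t0 \<Longrightarrow> emeasure \<mu> {0<..t} \<le> ennreal C * emeasure \<mu>' {0<..t}" by blast
  from assms(9) obtain n :: nat where "0 < q (real n)" by (auto simp: explosive_iff[OF rp] q_def)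
  \<comment> \<open>The intensities are compared only up to \<open>t0\<close>, so positivity is
    carried from a possibly large time down to \<open>t0\<close>.\<close>
  then have q_t0: "0 < q t0" unfolding q_def by (rule nonextinction_pos[OF pp]) (rule t0)
  \<comment> \<open>Only points after time 0 enter \<open>A\<close>; the intensity varies while the
    integrand keeps the same \<open>q\<close>, so that \<open>A \<mu>\<close> and
    \<open>A \<mu>'\<close> can be compared.\<close>
  define A where "A \<nu> t = (\<integral>s. indicator {0<..t} s * q (t - s) \<partial>\<nu>)" for \<nu> t
  \<comment> \<open>The comparison of intensities is stated for nonnegative extended integrals; as
    \<open>q\<close> is bounded and the interval has finite intensity, both kinds of integral
    agree.\<close>
  have A_nn: "ennreal (A \<nu> t) = (\<integral>\<^sup>+s. indicator {0<..t} s * ennreal (q (t - s)) \<partial>\<nu>)"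
    if p: "poisson_point_process N \<zeta> \<nu>" for N :: "'c measure" and \<zeta> \<nu> t
  proof -
    have "integrable \<nu> (\<lambda>s. indicator {0<..t} s * q (t - s))"
      using q by (intro integrable_intensity[OF p, where t=t]) auto
    then show ?thesis unfolding A_def
      using q by (subst nn_integral_eq_integral[symmetric])
        (auto simp: ennreal_mult' ennreal_indicator intro!: nn_integral_cong split: split_indicator)
  qed
  have A_le: "A \<mu> t \<le> C * A \<mu>' t" if t: "t \<le> t0" for t
  proof -
    have "antimono (\<lambda>s. q (t - s))"
      by (auto simp: antimono_def q_def intro: nonextinction_mono[OF rp])
    then have "(\<integral>\<^sup>+s. indicator {0<..t} s * ennreal (q (t - s)) \<partial>\<mu>) \<le>
        ennreal C * (\<integral>\<^sup>+s. indicator {0<..t} s * ennreal (q (t - s)) \<partial>\<mu>')"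
      using t by (intro nn_integral_antimono_le sets_intensity[OF pp] sets_intensity[OF pp']
          sigma_finite_intensity[OF pp] sigma_finite_intensity[OF pp'] le) auto
    then have "ennreal (A \<mu> t) \<le> ennreal (C * A \<mu>' t)"
      using C by (simp add: A_nn[OF pp] A_nn[OF pp'] ennreal_mult')
    moreover have "0 \<le> A \<mu>' t" using q unfolding A_def by (intro integral_nonneg_AE) auto
    ultimately show ?thesis using C by (simp add: ennreal_le_iff)
  qed
  \<comment> \<open>The candidate subsolution for \<open>\<mu>'\<close> on \<open>{0..t0}\<close>:
    maximality puts it below the nonextinction probability of \<open>\<xi>'\<close>, and it is
    positive at \<open>t0\<close>.\<close>
  define f where "f t = q t / C" for t
  have "f t0 \<le> nonextinction M' \<xi>' t0"
  proof (rule subsolution_le_nonextinction[OF pp', where f=f and T=t0])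
    show f_meas: "f \<in> borel_measurable borel" unfolding f_def using q(1) by measurable
    show f01: "0 \<le> f s" "f s \<le> 1" for s
      using q(2)[of s] q(3)[of s] C by (auto simp: f_def divide_le_eq)
    fix t assume t: "0 \<le> t" "t \<le> t0"
    have "q t = 1 - exp (- (q t + A \<mu> t))"
      using nonextinction_fixpoint[OF pp t(1)] integral_split_atom[OF pp assms(3) t(1) q]
      by (simp add: q_def A_def)
    from scaled_subsolution[OF q(2) this A_le[OF t(2)] C]
    have "f t \<le> 1 - exp (- (f t + A \<mu>' t / C))" by (simp add: f_def)
    also have "A \<mu>' t / C = (\<integral>s. indicator {0<..t} s * f (t - s) \<partial>\<mu>')"
      by (simp add: A_def f_def)
    also have "f t + \<dots> = (\<integral>s. indicator {0..t} s * f (t - s) \<partial>\<mu>')"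
      by (rule integral_split_atom[OF pp' assms(4) t(1) f_meas f01, symmetric])
    finally show "f t \<le> 1 - exp (- (\<integral>s. indicator {0..t} s * f (t - s) \<partial>\<mu>'))" .
  qed (use t0 in auto)
  moreover have "0 < f t0" using q_t0 C by (simp add: f_def)
  ultimately have pos: "0 < nonextinction M' \<xi>' t0" by linarith
  \<comment> \<open>\<open>explosive_iff\<close> asks for an integer time; monotonicity moves the
    positive value from \<open>t0\<close> up to one.\<close>
  obtain n :: nat where "t0 \<le> real n" using real_arch_simple by blast
  with pos nonextinction_mono[OF rp', of t0 "real n"] show ?thesis
    by (auto simp: explosive_iff[OF rp'] intro!: exI[of _ n])
qed

end
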